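(* For each $n \in \mathbb{N}$, there exist an $n$-dimensional simple polytope $P$ with $4n$ facets and a pair of vertices $\mathbf{u},\mathbf{v}$ of $P$ such that any coherent path from $\mathbf{u}$ to $\mathbf{v}$ is of length at least $2^n$. In particular, every shadow of $P$ for which both $\mathbf{u}$ and $\mathbf{v}$ are projected to the boundary must have exponentially many (in $n$) vertices.
   Context: An $n$-dimensional polytope is simple if each of its vertices lies in precisely $n$ facets. Coherent path (also called shadow path or coherent monotone path): let $\mathbf{u},\mathbf{v}$ be vertices of a polytope $P\subset\mathbb{R}^n$. A coherent path from $\mathbf{u}$ to $\mathbf{v}$ is determined by two vectors $\mathbf{w},\mathbf{c}\in\mathbb{R}^n$ that are uniquely maximized over $P$ at $\mathbf{u}$ and $\mathbf{v}$, respectively. It is the path consisting of every vertex of $P$ that maximizes $\lambda\mathbf{w}+(1-\lambda)\mathbf{c}$ for some $\lambda\in[0,1]$, listed as $\lambda$ decreases from $1$ to $0$. Precisely, it is a sequence of vertices $\mathbf{u}=\mathbf{v}_0,\mathbf{v}_1,\dots,\mathbf{v}_\ell=\mathbf{v}$, with consecutive vertices joined by an edge of $P$, such that there are $1=\lambda_0>\lambda_1>\dots>\lambda_\ell=0$ with $\mathbf{v}_i$ the unique maximizer over $P$ of $\lambda_i\mathbf{w}+(1-\lambda_i)\mathbf{c}$, and such that every vertex of $P$ maximizing $\lambda\mathbf{w}+(1-\lambda)\mathbf{c}$ for some $\lambda\in[0,1]$ is one of the $\mathbf{v}_i$. Its length is $\ell$, the number of edges. Here neither $\mathbf{w}$ nor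 $\mathbf{c}$ is fixed in advance. A shadow of $P$ is a two-dimensional polygon $\pi(P)$, where $\pi:\mathbb{R}^n\to\mathbb{R}^2$ is a linear map.
   Formalization: The formal theorem assumes n ≥ 2: for n = 1 the claim fails, since every 1-dimensional polytope is a segment with 2 facets (not 4) and coherent paths of length 1 < 2; n = 0 (a point, without two distinct vertices) is degenerate and also excluded. *)

theory Defs
  imports "HOL-Analysis.Analysis"
begin

definition simple_polytope :: "'a::euclidean_space set \<Rightarrow> bool" where
  "simple_polytope P \<longleftrightarrow>
     polytope P \<and>
     (\<forall>x. x extreme_point_of P \<longrightarrow> int (card {F. F facet_of P \<and> x \<in> F}) = aff_dim P)"

definition maximizer :: "'a::real_inner set \<Rightarrow> 'a \<Rightarrow> 'a \<Rightarrow> bool" where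
  "maximizer P w x \<longleftrightarrow> x \<in> P \<and> (\<forall>y\<in>P. w \<bullet> y \<le> w \<bullet> x)"

definition unique_maximizer :: "'a::real_inner set \<Rightarrow> 'a \<Rightarrow> 'a \<Rightarrow> bool" where
  "unique_maximizer P w x \<longleftrightarrow> maximizer P w x \<and> (\<forall>y. maximizer P w y \<longrightarrow> y = x)"

text \<open>The path has vertices \<open>p 0, \<dots>, p l\<close> and length \<open>l\<close>; the values of \<open>p\<close> and
  \<open>t\<close> beyond index \<open>l\<close> are irrelevant. Since \<open>t 0 = 1\<close> and \<open>t l = 0\<close>, the length \<open>l\<close>
  is positive, so there is no coherent path from a vertex to itself.\<close>

definition coherent_path_for ::
  "'a::euclidean_space set \<Rightarrow> 'a \<Rightarrow> 'a \<Rightarrow> 'a \<Rightarrow> 'a \<Rightarrow> nat \<Rightarrow> (nat \<Rightarrow> 'a) \<Rightarrow> bool" where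
  "coherent_path_for P w c u v l p \<longleftrightarrow>
     unique_maximizer P w u \<and> unique_maximizer P c v \<and>
     p 0 = u \<and> p l = v \<and>
     (\<forall>i\<le>l. p i extreme_point_of P) \<and>
     (\<forall>i<l. closed_segment (p i) (p (Suc i)) edge_of P) \<and>
     (\<exists>t :: nat \<Rightarrow> real. t 0 = 1 \<and> t l = 0 \<and> (\<forall>i<l. t (Suc i) < t i) \<and>
        (\<forall>i\<le>l. unique_maximizer P (t i *\<^sub>R w + (1 - t i) *\<^sub>R c) (p i))) \<and>
     (\<forall>x s. x extreme_point_of P \<and> 0 \<le> s \<and> s \<le> 1 \<and>
        maximizer P (s *\<^sub>R w + (1 - s) *\<^sub>R c) x \<longrightarrow> (\<exists>i\<le>l. x = p i))"

definition coherent_path ::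
  "'a::euclidean_space set \<Rightarrow> 'a \<Rightarrow> 'a \<Rightarrow> nat \<Rightarrow> (nat \<Rightarrow> 'a) \<Rightarrow> bool" where
  "coherent_path P u v l p \<longleftrightarrow> (\<exists>w c. coherent_path_for P w c u v l p)"

definition shadow_map :: "'a::euclidean_space set \<Rightarrow> ('a \<Rightarrow> real^2) \<Rightarrow> bool" where
  "shadow_map P \<pi> \<longleftrightarrow> linear \<pi> \<and> aff_dim (\<pi> ` P) = 2"

end

theory Submission
  imports Defs
begin

text \<open>
  Take a deformed cube with 2n facets such that all of its \<open>2 ^ n\<close> vertices lie on the shadow path
  between the maximizers \<open>u0\<close> and \<open>v0\<close> of two objectives \<open>w0\<close> and \<open>c0\<close>. Being the unique maximizer of
  an objective is an open condition, so each of these vertices remains on the path when \<open>w0\<close> and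
  \<open>c0\<close> are slightly perturbed. Now cut off \<open>u0\<close> by n hyperplanes, all nearly orthogonal to \<open>w0\<close>, that
  meet in a new vertex \<open>u\<close>, and likewise cut off \<open>v0\<close> with a new vertex \<open>v\<close>. The normal cones of \<open>u\<close>
  and \<open>v\<close> are so narrow that every coherent path from \<open>u\<close> to \<open>v\<close> is given by perturbations of \<open>w0\<close> and
  \<open>c0\<close>, and hence still visits the \<open>2 ^ n - 2\<close> vertices of the cube that were not cut off. It also
  visits \<open>u\<close>, \<open>v\<close> and the successor of \<open>u\<close>, which is none of the others because an edge from \<open>u\<close> has
  to stay on one of the cutting hyperplanes.
\<close>

section \<open>Polytopes given by inequalities\<close>

lemma unique_maximizer_iff:
  "unique_maximizer P w x \<longleftrightarrow> x \<in> P \<and> (\<forall>y\<in>P. y \<noteq> x \<longrightarrow> w \<bullet> y < w \<bullet> x)"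
proof
  assume l: "unique_maximizer P w x"
  then have x: "x \<in> P" "\<And>y. y \<in> P \<Longrightarrow> w \<bullet> y \<le> w \<bullet> x"
    by (simp_all add: unique_maximizer_def maximizer_def)
  have "w \<bullet> y < w \<bullet> x" if y: "y \<in> P" "y \<noteq> x" for y
  proof (rule ccontr)
    assume "\<not> ?thesis"
    then have "maximizer P w y" using x y by (force simp: maximizer_def)
    then show False using l y by (simp add: unique_maximizer_def)
  qed
  then show "x \<in> P \<and> (\<forall>y\<in>P. y \<noteq> x \<longrightarrow> w \<bullet> y < w \<bullet> x)" using x by blast
next
  assume r: "x \<in> P \<and> (\<forall>y\<in>P. y \<noteq> x \<longrightarrow> w \<bullet> y < w \<bullet> x)"
  then have "maximizer P w x" by (force simp: maximizer_def)
  moreover have "y = x" if "maximizer P w y" for y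
    using that r unfolding maximizer_def by (meson not_le)
  ultimately show "unique_maximizer P w x" unfolding unique_maximizer_def by blast
qed

lemma unique_maximizer_extreme:
  assumes "unique_maximizer P w x"
  shows "x extreme_point_of P"
proof (rule extreme_point_of_Int_supporting_hyperplane_le)
  show "P \<inter> {y. w \<bullet> y = w \<bullet> x} = {x}"
    using assms unfolding unique_maximizer_iff by force
  show "w \<bullet> y \<le> w \<bullet> x" if "y \<in> P" for y
    using assms that unfolding unique_maximizer_def maximizer_def by simp
qed

lemma unique_maximizer_mono:
  assumes "unique_maximizer Q w x" "P \<subseteq> Q" "x \<in> P"
  shows "unique_maximizer P w x"
  using assms unfolding unique_maximizer_iff by blast

lemma unique_maximizer_scale:
  assumes "unique_maximizer P w x" "t > 0"
  shows "unique_maximizer P (t *\<^sub>R w) x"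
  using assms by (simp add: unique_maximizer_iff)

text \<open>Only the finitely many extreme points matter: strict superiority of \<open>x\<close>
  over each of them is an open condition on the objective. It extends to every other point
  \<open>y\<close> of \<open>P\<close>, because a convex combination giving \<open>y\<close> must
  put positive weight on some extreme point other than \<open>x\<close>.\<close>

lemma unique_maximizer_open:
  fixes P :: "'a::euclidean_space set"
  assumes P: "polytope P" and um: "unique_maximizer P w x"
  shows "eventually (\<lambda>w'. unique_maximizer P w' x) (nhds w)"
proof -
  define E where "E = {y. y extreme_point_of P}"
  have finE: "finite E"
    using P unfolding E_def by (intro finite_polyhedron_extreme_points polytope_imp_polyhedron)
  have hull: "P = convex hull E"
    unfolding E_def by (simp add: Krein_Milman_Minkowski P polytope_imp_compact polytope_imp_convex)
  have xP: "x \<in> P" using um by (simp add: unique_maximizer_def maximizer_def)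
  have "eventually (\<lambda>w'. w' \<bullet> y < w' \<bullet> x) (nhds w)" if "y \<in> E - {x}" for y
  proof -
    have "w \<bullet> (x - y) > 0"
      using um that
      by (auto simp: unique_maximizer_iff E_def extreme_point_of_def inner_diff_right)
    moreover have "((\<lambda>w'. w' \<bullet> (x - y)) \<longlongrightarrow> w \<bullet> (x - y)) (nhds w)"
      by (intro tendsto_intros filterlim_ident)
    ultimately have "eventually (\<lambda>w'. w' \<bullet> (x - y) > 0) (nhds w)"
      using order_tendstoD(1) by blast
    then show ?thesis by (simp add: inner_diff_right)
  qed
  then have "eventually (\<lambda>w'. \<forall>y\<in>E - {x}. w' \<bullet> y < w' \<bullet> x) (nhds w)"
    using finE by (intro eventually_ball_finite) auto
  then show ?thesis
  proof eventually_elim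
    case (elim w')
    have xE: "x \<in> E" using unique_maximizer_extreme[OF um] by (simp add: E_def)
    have "w' \<bullet> y < w' \<bullet> x" if y: "y \<in> P" "y \<noteq> x" for y
    proof -
      obtain c where c: "\<And>e. e \<in> E \<Longrightarrow> 0 \<le> c e" "sum c E = 1" "(\<Sum>e\<in>E. c e *\<^sub>R e) = y"
        using y(1) unfolding hull convex_hull_finite[OF finE] by auto
      have "\<exists>e\<in>E - {x}. c e \<noteq> 0"
      proof (rule ccontr)
        assume "\<not> ?thesis"
        then have z: "\<forall>e\<in>E-{x}. c e = 0" by auto
        have "sum c E = c x" "(\<Sum>e\<in>E. c e *\<^sub>R e) = c x *\<^sub>R x"
          using z finE xE by (simp_all add: sum.remove[of E x])
        then show False using c y by auto
      qed
      then obtain e where e: "e \<in> E - {x}" "c e > 0" using c(1) by (metis DiffD1 order_le_less)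
      have "w' \<bullet> x - w' \<bullet> y = (\<Sum>e\<in>E. c e * (w' \<bullet> x - w' \<bullet> e))"
        unfolding c(3)[symmetric] using c(2)
        by (simp add: inner_sum_right right_diff_distrib sum_subtractf flip: sum_distrib_right)
      also have "\<dots> > 0"
      proof (rule sum_pos2[OF finE, of e])
        show "0 < c e * (w' \<bullet> x - w' \<bullet> e)" using e elim by simp
        show "0 \<le> c i * (w' \<bullet> x - w' \<bullet> i)" if "i \<in> E" for i
          using elim that c(1)[OF that] by (cases "i = x") (auto simp: less_imp_le)
      qed (use e in auto)
      finally show ?thesis by simp
    qed
    then show ?case using xP by (simp add: unique_maximizer_iff)
  qed
qed

section \<open>Edges, facets and vertices of an indexed system of inequalities\<close>

definition hpoly :: "'j set \<Rightarrow> ('j \<Rightarrow> 'a::euclidean_space) \<Rightarrow> ('j \<Rightarrow> real) \<Rightarrow> 'a set" where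
  "hpoly J A B = {x. \<forall>j\<in>J. A j \<bullet> x \<le> B j}"

lemma polyhedron_hpoly: "finite J \<Longrightarrow> polyhedron (hpoly J A B)"
proof -
  assume "finite J"
  moreover have "hpoly J A B = \<Inter>((\<lambda>j. {x. A j \<bullet> x \<le> B j}) ` J)"
    by (auto simp: hpoly_def)
  ultimately show ?thesis by (auto intro!: polyhedron_Inter polyhedron_halfspace_le)
qed

lemma interior_hpoly:
  assumes "finite J" "\<forall>j\<in>J. A j \<bullet> x < B j"
  shows "x \<in> interior (hpoly J A B)"
proof (rule interiorI)
  have "{y. \<forall>j\<in>J. A j \<bullet> y < B j} = (\<Inter>j\<in>J. {y. A j \<bullet> y < B j})" by auto
  then show "open {y. \<forall>j\<in>J. A j \<bullet> y < B j}"
    using assms by (auto intro!: open_INT open_halfspace_lt)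
qed (use assms in \<open>auto simp: hpoly_def less_imp_le\<close>)

text \<open>Constraints that are slack at \<open>x\<close> survive a short step by continuity, tight
  ones by the choice of \<open>D\<close>; finiteness of \<open>J\<close> gives one step length for
  all.\<close>

lemma hpoly_feasible_direction:
  assumes "finite J" "x \<in> hpoly J A B" "\<And>j. j \<in> J \<Longrightarrow> A j \<bullet> x = B j \<Longrightarrow> A j \<bullet> D \<le> 0"
  shows "eventually (\<lambda>t. x + t *\<^sub>R D \<in> hpoly J A B) (at_right 0)"
proof -
  have "eventually (\<lambda>t. A j \<bullet> (x + t *\<^sub>R D) \<le> B j) (at_right 0)" if j: "j \<in> J" for j
  proof (cases "A j \<bullet> x = B j")
    case True
    show ?thesis
      using eventually_at_right_less[of 0]
      by eventually_elim
         (use assms(3)[OF j True] True in \<open>simp add: inner_add_right mult_nonneg_nonpos\<close>)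
  next
    case False
    then have "A j \<bullet> (x + 0 *\<^sub>R D) < B j" using assms(2) j by (force simp: hpoly_def)
    moreover have "((\<lambda>t. A j \<bullet> (x + t *\<^sub>R D)) \<longlongrightarrow> A j \<bullet> (x + 0 *\<^sub>R D)) (at_right 0)"
      by (intro tendsto_intros)
    ultimately have "eventually (\<lambda>t. A j \<bullet> (x + t *\<^sub>R D) < B j) (at_right 0)"
      using order_tendstoD(2) by blast
    then show ?thesis by eventually_elim simp
  qed
  then show ?thesis
    unfolding hpoly_def using assms(1) by (simp add: eventually_ball_finite_distrib)
qed

lemma hpoly_feasible_direction_strict:
  assumes "finite J" "x \<in> hpoly J A B" "\<And>j. j \<in> J \<Longrightarrow> A j \<bullet> x = B j \<Longrightarrow> A j \<bullet> D < 0"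
  shows "eventually (\<lambda>t. \<forall>j\<in>J. A j \<bullet> (x + t *\<^sub>R D) < B j) (at_right 0)"
proof -
  have "eventually (\<lambda>t. A j \<bullet> (x + t *\<^sub>R D) < B j) (at_right 0)" if j: "j \<in> J" for j
  proof (cases "A j \<bullet> x = B j")
    case True
    show ?thesis
      using eventually_at_right_less[of 0]
      by eventually_elim
         (use assms(3)[OF j True] True in \<open>simp add: inner_add_right mult_pos_neg\<close>)
  next
    case False
    then have "A j \<bullet> (x + 0 *\<^sub>R D) < B j" using assms(2) j by (force simp: hpoly_def)
    moreover have "((\<lambda>t. A j \<bullet> (x + t *\<^sub>R D)) \<longlongrightarrow> A j \<bullet> (x + 0 *\<^sub>R D)) (at_right 0)"
      by (intro tendsto_intros)
    ultimately show ?thesis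
      using order_tendstoD(2) by blast
  qed
  then show ?thesis
    using assms(1) by (simp add: eventually_ball_finite_distrib)
qed

text \<open>Shortly after \<open>u\<close>, the segment towards \<open>x\<close> satisfies all
  constraints strictly and so enters the interior. In dimension at least 2 an edge is a proper face
  and cannot do that.\<close>

lemma hpoly_not_edge:
  fixes A :: "'j \<Rightarrow> 'a::euclidean_space"
  assumes fin: "finite J" and uP: "u \<in> hpoly J A B" and xP: "x \<in> hpoly J A B"
    and dim: "aff_dim (hpoly J A B) \<ge> 2"
    and strict: "\<And>j. j \<in> J \<Longrightarrow> A j \<bullet> u = B j \<Longrightarrow> A j \<bullet> x < B j"
  shows "\<not> closed_segment u x edge_of hpoly J A B"
proof
  assume e: "closed_segment u x edge_of hpoly J A B"
  have "eventually (\<lambda>t. \<forall>j\<in>J. A j \<bullet> (u + t *\<^sub>R (x - u)) < B j) (at_right 0)"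
    using strict by (intro hpoly_feasible_direction_strict fin uP) (force simp: inner_diff_right)
  moreover have "eventually (\<lambda>t::real. t < 1) (at_right 0)"
    by (intro order_tendstoD(2)[OF tendsto_ident_at]) simp
  moreover have "eventually (\<lambda>t::real. 0 < t) (at_right 0)"
    by (rule eventually_at_right_less)
  ultimately have "eventually (\<lambda>t. (\<forall>j\<in>J. A j \<bullet> (u + t *\<^sub>R (x - u)) < B j) \<and> t < 1 \<and> 0 < t) (at_right 0)"
    by eventually_elim simp
  from eventually_happens[OF this] obtain t :: real where t: "\<forall>j\<in>J. A j \<bullet> (u + t *\<^sub>R (x - u)) < B j" "t < 1" "0 < t"
    by auto
  have "u + t *\<^sub>R (x - u) \<in> closed_segment u x"
    using t unfolding in_segment by (auto simp: algebra_simps intro!: exI[of _ t])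
  moreover have "u + t *\<^sub>R (x - u) \<in> interior (hpoly J A B)"
    using interior_hpoly[OF fin t(1)] .
  moreover have "closed_segment u x \<inter> interior (hpoly J A B) = {}"
    using e dim by (intro face_of_disjoint_interior) (auto simp: edge_of_def)
  ultimately show False by blast
qed

text \<open>The points in \<open>wit\<close> show that no constraint is redundant and that no two of
  them define the same facet, so facets correspond one-to-one to indices.\<close>

lemma hpoly_facets:
  fixes A :: "'j \<Rightarrow> 'a::euclidean_space"
  assumes fin: "finite J" and x0: "\<And>j. j \<in> J \<Longrightarrow> A j \<bullet> x0 < B j"
    and wit: "\<And>j. j \<in> J \<Longrightarrow> \<exists>x. A j \<bullet> x = B j \<and> (\<forall>i\<in>J - {j}. A i \<bullet> x < B i)"
  shows "aff_dim (hpoly J A B) = DIM('a)"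
    and "{F. F facet_of hpoly J A B} = (\<lambda>j. hpoly J A B \<inter> {x. A j \<bullet> x = B j}) ` J"
    and "inj_on (\<lambda>j. hpoly J A B \<inter> {x. A j \<bullet> x = B j}) J"
proof -
  define H where "H j = {x. A j \<bullet> x \<le> B j}" for j
  \<comment> \<open>The characterization of facets applied below works with a set of half-spaces;
    \<open>f\<close> leads from a half-space back to its index.\<close>
  define f where "f = inv_into J H"
  obtain z where z: "\<And>j. j \<in> J \<Longrightarrow> A j \<bullet> z j = B j" "\<And>j i. j \<in> J \<Longrightarrow> i \<in> J \<Longrightarrow> i \<noteq> j \<Longrightarrow> A i \<bullet> z j < B i"
    using wit by (metis DiffI singletonD)
  have int: "interior (hpoly J A B) \<noteq> {}"
    using interior_hpoly[OF fin] x0 by blast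
  then show dim: "aff_dim (hpoly J A B) = DIM('a)"
    by (metis empty_interior_lowdim int aff_dim_nonempty_interior)
  have aff: "affine hull (hpoly J A B) = UNIV"
    by (simp add: affine_hull_nonempty_interior int)
  have Aneq0: "A j \<noteq> 0" if "j \<in> J" for j
    using x0[OF that] z(1)[OF that] by auto
  \<comment> \<open>pushing the witness of facet j slightly outwards violates constraint j only\<close>
  have out: "\<exists>y. A j \<bullet> y > B j \<and> (\<forall>i\<in>J - {j}. A i \<bullet> y \<le> B i)" if j: "j \<in> J" for j
  proof -
    have "eventually (\<lambda>t. z j + t *\<^sub>R A j \<in> hpoly (J - {j}) A B) (at_right 0)"
      using fin z(2)[OF j] by (intro hpoly_feasible_direction) (fastforce simp: hpoly_def less_imp_le)+
    moreover have "eventually (\<lambda>t::real. 0 < t) (at_right 0)"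
      by (rule eventually_at_right_less)
    ultimately have "eventually (\<lambda>t. z j + t *\<^sub>R A j \<in> hpoly (J - {j}) A B \<and> 0 < t) (at_right 0)"
      by eventually_elim simp
    from eventually_happens[OF this] obtain t :: real where t: "z j + t *\<^sub>R A j \<in> hpoly (J - {j}) A B" "0 < t"
      by auto
    have "A j \<bullet> (z j + t *\<^sub>R A j) > B j"
      using t(2) z(1)[OF j] Aneq0[OF j] by (simp add: inner_add_right)
    then show ?thesis using t(1) by (auto simp: hpoly_def)
  qed
  have injH: "inj_on H J"
  proof (rule inj_onI, rule ccontr)
    fix i j assume ij: "i \<in> J" "j \<in> J" "H i = H j" "i \<noteq> j"
    obtain y where "A j \<bullet> y > B j" "A i \<bullet> y \<le> B i" using out[OF ij(2)] ij by blast
    then have "y \<in> H i" "y \<notin> H j" by (auto simp: H_def)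
    then show False using ij by auto
  qed
  have f: "f (H j) = j" if "j \<in> J" for j
    using that injH by (simp add: f_def)
  have eq: "hpoly J A B = affine hull hpoly J A B \<inter> \<Inter>(H ` J)"
    unfolding aff by (auto simp: hpoly_def H_def)
  have "F facet_of hpoly J A B \<longleftrightarrow> (\<exists>h. h \<in> H ` J \<and> F = hpoly J A B \<inter> {x. A (f h) \<bullet> x = B (f h)})" for F
  proof (rule facet_of_polyhedron_explicit[OF _ eq])
    show "A (f h) \<noteq> 0 \<and> h = {x. A (f h) \<bullet> x \<le> B (f h)}" if "h \<in> H ` J" for h
      using that f Aneq0 by (auto simp: H_def)
    show "hpoly J A B \<subset> affine hull hpoly J A B \<inter> \<Inter>F'" if F': "F' \<subset> H ` J" for F'
    proof -
      obtain j where j: "j \<in> J" "H j \<notin> F'" using F' by auto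
      obtain y where y: "A j \<bullet> y > B j" "\<forall>i\<in>J - {j}. A i \<bullet> y \<le> B i" using out[OF j(1)] by blast
      have "y \<in> \<Inter>F'"
        using y(2) F' j by (force simp: H_def)
      moreover have "y \<notin> hpoly J A B" using y(1) j(1) by (force simp: hpoly_def)
      moreover have "hpoly J A B \<subseteq> \<Inter>F'" using F' by (subst eq) auto
      ultimately show ?thesis unfolding aff by blast
    qed
  qed (use fin in auto)
  then show "{F. F facet_of hpoly J A B} = (\<lambda>j. hpoly J A B \<inter> {x. A j \<bullet> x = B j}) ` J"
    using f by (auto simp: image_iff)
  show "inj_on (\<lambda>j. hpoly J A B \<inter> {x. A j \<bullet> x = B j}) J"
  proof (rule inj_onI, rule ccontr)
    fix i j assume ij: "i \<in> J" "j \<in> J" "hpoly J A B \<inter> {x. A i \<bullet> x = B i} = hpoly J A B \<inter> {x. A j \<bullet> x = B j}" "i \<noteq> j"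
    have "z i \<in> hpoly J A B"
      using z ij by (force simp: hpoly_def)
    then have "A j \<bullet> z i = B j" using ij z(1)[of i] by blast
    then show False using z(2)[of i j] ij by simp
  qed
qed

text \<open>With fewer tight constraints, some nonzero \<open>d\<close> would be orthogonal to all
  tight normals. Then \<open>x\<close> could be moved both along \<open>d\<close> and along
  \<open>- d\<close>, and would be the midpoint of a segment in the polyhedron.\<close>

lemma hpoly_extreme_point_tight:
  fixes A :: "'j \<Rightarrow> 'a::euclidean_space"
  assumes fin: "finite J" and x: "x extreme_point_of hpoly J A B"
  shows "DIM('a) \<le> card {j\<in>J. A j \<bullet> x = B j}"
proof (rule ccontr)
  define T where "T = {j\<in>J. A j \<bullet> x = B j}"
  assume "\<not> ?thesis"
  then have "card T < DIM('a)" by (simp add: T_def)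
  moreover have "dim (A ` T) \<le> card T"
    using fin by (metis (no_types, lifting) T_def card_image_le dim_le_card' dual_order.trans finite_imageI finite_subset mem_Collect_eq subsetI)
  ultimately have "dim (A ` T) < DIM('a)" by linarith
  then obtain d where d: "d \<noteq> 0" "span (A ` T) \<subseteq> {y. d \<bullet> y = 0}"
    using lowdim_subset_hyperplane by blast
  have orth: "A j \<bullet> d = 0" if "j \<in> J" "A j \<bullet> x = B j" for j
  proof -
    have "A j \<in> span (A ` T)" using that by (intro span_base) (auto simp: T_def)
    then show ?thesis using d(2) by (auto simp: inner_commute)
  qed
  have xP: "x \<in> hpoly J A B" using x by (simp add: extreme_point_of_def)
  have "eventually (\<lambda>t. x + t *\<^sub>R d \<in> hpoly J A B) (at_right 0)"
    "eventually (\<lambda>t. x + t *\<^sub>R (- d) \<in> hpoly J A B) (at_right 0)"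
    using orth by (intro hpoly_feasible_direction fin xP; simp)+
  moreover have "eventually (\<lambda>t::real. 0 < t) (at_right 0)"
    by (rule eventually_at_right_less)
  ultimately have "eventually (\<lambda>t. x + t *\<^sub>R d \<in> hpoly J A B \<and> x + t *\<^sub>R (- d) \<in> hpoly J A B \<and> 0 < t) (at_right 0)"
    by eventually_elim simp
  from eventually_happens[OF this] obtain t :: real
    where t: "x + t *\<^sub>R d \<in> hpoly J A B" "x + t *\<^sub>R (- d) \<in> hpoly J A B" "0 < t"
    by auto
  have "midpoint (x + t *\<^sub>R d) (x + t *\<^sub>R (- d)) = x"
    by (simp add: midpoint_def flip: scaleR_2)
  moreover have "x + t *\<^sub>R d \<noteq> x + t *\<^sub>R (- d)"
    using t(3) d(1) by (simp add: eq_neg_iff_add_eq_0 flip: scaleR_2)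
  ultimately have "x \<in> open_segment (x + t *\<^sub>R d) (x + t *\<^sub>R (- d))"
    using midpoint_in_open_segment by metis
  then show False using x t by (auto simp: extreme_point_of_def)
qed

text \<open>A vertex has at least \<open>DIM('a)\<close> tight constraints in any case. The
  labelling \<open>g\<close> gives the converse bound: constraints with the same label are never
  tight together, and there are only \<open>DIM('a)\<close> labels.\<close>

lemma simple_polytope_hpoly:
  fixes A :: "'j \<Rightarrow> 'a::euclidean_space"
  assumes fin: "finite J" and bdd: "bounded (hpoly J A B)"
    and x0: "\<And>j. j \<in> J \<Longrightarrow> A j \<bullet> x0 < B j"
    and wit: "\<And>j. j \<in> J \<Longrightarrow> \<exists>x. A j \<bullet> x = B j \<and> (\<forall>i\<in>J - {j}. A i \<bullet> x < B i)"
    and K: "finite K" "card K = DIM('a)" "g ` J \<subseteq> K"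
    and inj: "\<And>x. x \<in> hpoly J A B \<Longrightarrow> inj_on g {j\<in>J. A j \<bullet> x = B j}"
  shows "simple_polytope (hpoly J A B)"
  unfolding simple_polytope_def
proof (intro conjI allI impI)
  show "polytope (hpoly J A B)"
    using polyhedron_hpoly[OF fin] bdd by (simp add: polytope_eq_bounded_polyhedron)
  fix x assume x: "x extreme_point_of hpoly J A B"
  then have xP: "x \<in> hpoly J A B" by (simp add: extreme_point_of_def)
  define F where "F j = hpoly J A B \<inter> {x. A j \<bullet> x = B j}" for j
  define T where "T = {j\<in>J. A j \<bullet> x = B j}"
  note facets = hpoly_facets[OF fin x0 wit, folded F_def]
  have "{G. G facet_of hpoly J A B \<and> x \<in> G} = {G. G facet_of hpoly J A B} \<inter> {G. x \<in> G}"
    by auto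
  also have "\<dots> = F ` J \<inter> {G. x \<in> G}"
    by (simp only: facets(2))
  also have "\<dots> = F ` T"
    using xP by (auto simp: T_def F_def)
  finally have "card {G. G facet_of hpoly J A B \<and> x \<in> G} = card T"
    using inj_on_subset[OF facets(3), of T] by (simp add: T_def card_image)
  moreover have "DIM('a) \<le> card T"
    using hpoly_extreme_point_tight[OF fin x] by (simp add: T_def)
  moreover have "card T \<le> card K"
    using inj[OF xP] K by (intro card_inj_on_le[of g]) (auto simp: T_def)
  ultimately show "int (card {G. G facet_of hpoly J A B \<and> x \<in> G}) = aff_dim (hpoly J A B)"
    using facets(1) K by simp
qed

section \<open>The deformed cube\<close>

lemma span_image_imp_sum:
  fixes f :: "'i \<Rightarrow> 'a::real_vector"
  assumes "finite I" "inj_on f I" "x \<in> span (f ` I)"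
  shows "\<exists>c. x = (\<Sum>i\<in>I. c i *\<^sub>R f i)"
proof -
  obtain c where "x = (\<Sum>v\<in>f ` I. c v *\<^sub>R v)"
    using assms span_finite[of "f ` I"] by auto
  then show ?thesis
    using assms(2) by (auto simp: sum.reindex intro!: exI[of _ "c \<circ> f"])
qed

text \<open>Solving \<open>sum_facet_normal_telescope\<close> for multipliers that make every coefficient below index \<open>m - 1\<close>
  vanish gives this recursion; its monotonicity puts every vertex on the same shadow path.\<close>

fun multiplier :: "(nat \<Rightarrow> real) \<Rightarrow> nat \<Rightarrow> real" where
  "multiplier \<sigma> 0 = 0"
| "multiplier \<sigma> (Suc 0) = 1"
| "multiplier \<sigma> (Suc (Suc k)) = 2 * multiplier \<sigma> (Suc k) + \<sigma> k * multiplier \<sigma> k"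

text \<open>Even for the sign -1 the increment is
  \<open>multiplier \<sigma> (Suc k) - multiplier \<sigma> k\<close>, which is positive by
  induction.\<close>

lemma multiplier_increasing:
  assumes "\<And>k. \<sigma> k \<in> {1, - 1}"
  shows "0 \<le> multiplier \<sigma> k \<and> multiplier \<sigma> k < multiplier \<sigma> (Suc k)"
proof (induction k)
  case (Suc k)
  then show ?case using assms[of k] by auto
qed simp

text \<open>The numbering of the basis orders the coordinates for the recursive constraints, and
  \<open>b 0 = 0\<close> acts as a zeroth coordinate that is always 0.\<close>

locale deformed_cube =
  fixes b :: "nat \<Rightarrow> 'a::euclidean_space" and N :: nat
  assumes bij_b: "bij_betw b {1..N} Basis" and b_0 [simp]: "b 0 = 0" and N_ge_2: "2 \<le> N"
begin

lemma DIM_eq: "DIM('a) = N"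
  using bij_betw_same_card[OF bij_b] by simp

lemma b_inner: "i \<in> {1..N} \<Longrightarrow> j \<in> {1..N} \<Longrightarrow> b i \<bullet> b j = (if i = j then 1 else 0)"
  using bij_betwE[OF bij_b] inj_on_eq_iff[OF bij_betw_imp_inj_on[OF bij_b]]
  by (simp add: inner_Basis)

lemma b_orthogonal: "i < j \<Longrightarrow> j \<le> N \<Longrightarrow> b i \<bullet> b j = 0"
  by (cases "i = 0") (auto simp: b_inner)

lemma Basis_eq_b: "i \<in> Basis \<Longrightarrow> \<exists>k\<in>{1..N}. i = b k"
  using bij_betw_imp_surj_on[OF bij_b] by blast

lemma coordinates_eqI:
  assumes "\<And>k. k \<in> {1..N} \<Longrightarrow> b k \<bullet> x = b k \<bullet> y"
  shows "x = y"
proof (rule euclidean_eqI)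
  fix i :: 'a assume "i \<in> Basis"
  then obtain k where "k \<in> {1..N}" "i = b k" using Basis_eq_b by blast
  then show "x \<bullet> i = y \<bullet> i" using assms by (simp add: inner_commute)
qed

text \<open>The constraint with normal \<open>facet_normal s k\<close> reads \<open>s x_k \<le> 10^k - 2 x_(k-1) + x_(k-2)\<close>; the right-hand
  sides grow fast enough to keep the two constraints for each k apart. As \<open>b 0 = 0\<close>, the truncated
  subtraction \<open>k - 2\<close> does no harm for \<open>k = 1\<close>.\<close>

definition facet_normal :: "real \<Rightarrow> nat \<Rightarrow> 'a" where
  "facet_normal s k = s *\<^sub>R b k + 2 *\<^sub>R b (k - 1) - b (k - 2)"

definition slack :: "real \<Rightarrow> nat \<Rightarrow> 'a \<Rightarrow> real" where
  "slack s k x = 10 ^ k - facet_normal s k \<bullet> x"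

text \<open>The two constraints of index \<open>k\<close> confine coordinate \<open>k\<close> to an
  interval around 0. This is its half-length, which depends only on the two preceding
  coordinates.\<close>

definition radius :: "nat \<Rightarrow> 'a \<Rightarrow> real" where
  "radius k x = 10 ^ k - 2 * (b (k - 1) \<bullet> x) + b (k - 2) \<bullet> x"

definition cube :: "'a set" where
  "cube = {x. \<forall>s\<in>{1, - 1}. \<forall>k\<in>{1..N}. 0 \<le> slack s k x}"

section \<open>Bounds on coordinates and slacks\<close>

lemma slack_eq: "slack s k x = radius k x - s * (b k \<bullet> x)"
  by (simp add: slack_def radius_def facet_normal_def inner_add_left inner_diff_left)

text \<open>For \<open>k = Suc m\<close> the radius deviates from \<open>10 ^ k\<close> by at most
  \<open>4 * 10 ^ m + 2 * 10 ^ m\<close>, that is, by six tenths of \<open>10 ^ k\<close>.\<close>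

lemma radius_bounds:
  assumes "\<And>j. j < k \<Longrightarrow> \<bar>b j \<bullet> x\<bar> \<le> 2 * 10 ^ j" "1 \<le> k"
  shows "4 \<le> radius k x" "radius k x \<le> 16 / 10 * 10 ^ k"
proof -
  obtain m where m: "k = Suc m" using assms(2) by (cases k) auto
  have "\<bar>b m \<bullet> x\<bar> \<le> 2 * 10 ^ m" "\<bar>b (m - 1) \<bullet> x\<bar> \<le> 2 * 10 ^ (m - 1)"
    using assms(1) m by auto
  moreover have "(10::real) ^ (m - 1) \<le> 10 ^ m" by (rule power_increasing) auto
  moreover have "(1::real) \<le> 10 ^ m" by simp
  moreover have "radius k x = 10 * 10 ^ m - 2 * (b m \<bullet> x) + b (m - 1) \<bullet> x"
    by (simp add: radius_def m)
  moreover have "(10::real) ^ k = 10 * 10 ^ m" by (simp add: m)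
  ultimately show "4 \<le> radius k x" "radius k x \<le> 16 / 10 * 10 ^ k"
    by linarith+
qed

text \<open>The absolute value and the summand 1 in the hypothesis admit points with prescribed
  slacks in [0, 1] that are not yet known to lie in the cube. The induction closes since
  \<open>16 / 10 * 10 ^ k + 1\<close> is below \<open>2 * 10 ^ k\<close>.\<close>

lemma coordinate_bound:
  assumes "\<And>k. k \<in> {1..N} \<Longrightarrow> \<bar>b k \<bullet> x\<bar> \<le> \<bar>radius k x\<bar> + 1" "k \<le> N"
  shows "\<bar>b k \<bullet> x\<bar> \<le> 2 * 10 ^ k"
  using assms(2)
proof (induction k rule: less_induct)
  case (less k)
  show ?case
  proof (cases "k = 0")
    case False
    then have "\<bar>b k \<bullet> x\<bar> \<le> \<bar>radius k x\<bar> + 1" using assms(1) less by simp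
    moreover have IH: "\<bar>b j \<bullet> x\<bar> \<le> 2 * 10 ^ j" if "j < k" for j
      using less that by simp
    have "4 \<le> radius k x" "radius k x \<le> 16 / 10 * 10 ^ k"
      using radius_bounds[OF IH] False by simp_all
    moreover have "(10::real) ^ 1 \<le> 10 ^ k" using False by (intro power_increasing) auto
    ultimately show ?thesis by (auto simp: abs_if split: if_splits)
  qed simp
qed

lemma radius_ge_4:
  assumes "\<And>k. k \<in> {1..N} \<Longrightarrow> \<bar>b k \<bullet> x\<bar> \<le> \<bar>radius k x\<bar> + 1" "k \<in> {1..N}"
  shows "4 \<le> radius k x"
  using coordinate_bound[OF assms(1)] assms(2) by (intro radius_bounds) auto

lemma slack_opposite: "slack s k x + slack (- s) k x = 2 * radius k x"
  by (simp add: slack_eq)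

lemma cube_coordinate_le_radius:
  assumes "x \<in> cube" "k \<in> {1..N}"
  shows "\<bar>b k \<bullet> x\<bar> \<le> radius k x"
proof -
  have "0 \<le> slack 1 k x" "0 \<le> slack (- 1) k x" using assms by (auto simp: cube_def)
  then show ?thesis by (auto simp: slack_eq)
qed

text \<open>The sum is twice the radius. This margin is what keeps opposite facets, and later the
  two groups of cuts, apart.\<close>

lemma cube_slack_opposite_ge:
  assumes "x \<in> cube" "k \<in> {1..N}"
  shows "8 \<le> slack s k x + slack (- s) k x"
proof -
  have "4 \<le> radius k x"
    using cube_coordinate_le_radius[OF assms(1)] assms(2)
    by (intro radius_ge_4) force+
  then show ?thesis by (simp add: slack_opposite)
qed

lemma bounded_cube: "bounded cube"
proof -
  have "norm x \<le> real N * (2 * 10 ^ N)" if x: "x \<in> cube" for x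
  proof -
    have le: "\<bar>x \<bullet> i\<bar> \<le> 2 * 10 ^ N" if i: "i \<in> Basis" for i
    proof -
      obtain k where k: "k \<in> {1..N}" "i = b k" using Basis_eq_b[OF i] by blast
      have "\<bar>b k \<bullet> x\<bar> \<le> 2 * 10 ^ k"
        using cube_coordinate_le_radius[OF x] k by (intro coordinate_bound) force+
      also have "(10::real) ^ k \<le> 10 ^ N" using k by (intro power_increasing) auto
      finally show ?thesis using k by (simp add: inner_commute)
    qed
    have "norm x \<le> (\<Sum>i\<in>Basis. \<bar>x \<bullet> i\<bar>)" by (rule norm_le_l1)
    also have "\<dots> \<le> of_nat (card (Basis::'a set)) * (2 * 10 ^ N)" using le by (rule sum_bounded_above)
    finally show ?thesis by (simp add: DIM_eq)
  qed
  then show ?thesis by (auto simp: bounded_iff)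
qed

lemma polytope_cube: "polytope cube"
proof -
  have "cube = hpoly ({1, - 1} \<times> {1..N}) (\<lambda>(s, k). facet_normal s k) (\<lambda>(s, k). 10 ^ k)"
    by (auto simp: cube_def hpoly_def slack_def)
  then show ?thesis
    using bounded_cube by (simp add: polytope_eq_bounded_polyhedron polyhedron_hpoly)
qed

section \<open>Triangular systems of facet normals\<close>

lemma facet_normal_inner_b:
  assumes "k \<in> {1..j}" "j \<le> N"
  shows "facet_normal s k \<bullet> b j = (if k = j then s else 0)"
  using assms by (auto simp: facet_normal_def inner_add_left inner_diff_left b_orthogonal b_inner)

text \<open>Forward substitution: adding a multiple of \<open>b (Suc m)\<close> repairs equation
  \<open>Suc m\<close> and leaves the earlier equations intact.\<close>

lemma facet_normal_system_solvable:
  assumes "\<And>k. \<sigma> k \<noteq> 0"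
  shows "\<exists>x. \<forall>k\<in>{1..N}. facet_normal (\<sigma> k) k \<bullet> x = \<eta> k"
proof -
  have "m \<le> N \<Longrightarrow> \<exists>x. \<forall>k\<in>{1..m}. facet_normal (\<sigma> k) k \<bullet> x = \<eta> k" for m
  proof (induction m)
    case (Suc m)
    then obtain x where x: "\<forall>k\<in>{1..m}. facet_normal (\<sigma> k) k \<bullet> x = \<eta> k" by auto
    define c where "c = (\<eta> (Suc m) - facet_normal (\<sigma> (Suc m)) (Suc m) \<bullet> x) / \<sigma> (Suc m)"
    have "facet_normal (\<sigma> k) k \<bullet> (x + c *\<^sub>R b (Suc m)) = \<eta> k" if "k \<in> {1..Suc m}" for k
    proof (cases "k = Suc m")
      case True
      then show ?thesis
        using Suc.prems assms[of "Suc m"] by (simp add: inner_add_right facet_normal_inner_b c_def)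
    next
      case False
      then show ?thesis
        using Suc.prems x that by (simp add: inner_add_right facet_normal_inner_b)
    qed
    then show ?case by blast
  qed simp
  then show ?thesis by blast
qed

lemma facet_normal_system_unique:
  assumes "\<And>k. \<sigma> k \<noteq> 0" and eq: "\<And>k. k \<in> {1..N} \<Longrightarrow> facet_normal (\<sigma> k) k \<bullet> x = facet_normal (\<sigma> k) k \<bullet> y"
  shows "x = y"
proof (rule coordinates_eqI)
  have "k \<le> N \<Longrightarrow> b k \<bullet> x = b k \<bullet> y" for k
  proof (induction k rule: less_induct)
    case (less k)
    show ?case
    proof (cases "k = 0")
      case False
      then have "b (k - 1) \<bullet> x = b (k - 1) \<bullet> y" "b (k - 2) \<bullet> x = b (k - 2) \<bullet> y"
        using less by auto
      then show ?thesis
        using eq[of k] False less(2) assms(1)[of k] by (simp add: facet_normal_def inner_add_left inner_diff_left)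
    qed simp
  qed
  then show "b k \<bullet> x = b k \<bullet> y" if "k \<in> {1..N}" for k using that by simp
qed

text \<open>The normals with one sign per index span the space, since a vector orthogonal to all of
  them solves the homogeneous system. So every objective has weights with respect to the facets at a
  vertex.\<close>

lemma facet_normal_combination:
  assumes "\<And>k. \<sigma> k \<noteq> 0"
  shows "\<exists>c. w = (\<Sum>k=1..N. c k *\<^sub>R facet_normal (\<sigma> k) k)"
proof (rule span_image_imp_sum)
  show "inj_on (\<lambda>k. facet_normal (\<sigma> k) k) {1..N}"
  proof (rule linorder_inj_onI)
    fix i j assume "i < j" "i \<in> {1..N}" "j \<in> {1..N}"
    then have "facet_normal (\<sigma> i) i \<bullet> b j = 0" "facet_normal (\<sigma> j) j \<bullet> b j \<noteq> 0"
      using assms by (simp_all add: facet_normal_inner_b)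
    then show "facet_normal (\<sigma> i) i \<noteq> facet_normal (\<sigma> j) j" by metis
  qed auto
  have "span ((\<lambda>k. facet_normal (\<sigma> k) k) ` {1..N}) = UNIV"
  proof (rule ccontr)
    assume "\<not> ?thesis"
    then obtain a where a: "a \<noteq> 0" "\<forall>x\<in>span ((\<lambda>k. facet_normal (\<sigma> k) k) ` {1..N}). a \<bullet> x = 0"
      using span_not_UNIV_orthogonal by blast
    have "a = 0"
    proof (rule facet_normal_system_unique[OF assms])
      fix k assume "k \<in> {1..N}"
      then have "a \<bullet> facet_normal (\<sigma> k) k = 0" using a(2) span_base[OF imageI[of k "{1..N}" "\<lambda>k. facet_normal (\<sigma> k) k"]] by blast
      then show "facet_normal (\<sigma> k) k \<bullet> a = facet_normal (\<sigma> k) k \<bullet> 0" by (simp add: inner_commute)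
    qed
    then show False using a by simp
  qed
  then show "w \<in> span ((\<lambda>k. facet_normal (\<sigma> k) k) ` {1..N})" by simp
qed simp

text \<open>The witness exists only for nonvanishing signs \<open>\<sigma>\<close>.\<close>

definition slack_point :: "(nat \<Rightarrow> real) \<Rightarrow> (nat \<Rightarrow> real) \<Rightarrow> 'a" where
  "slack_point \<sigma> \<eta> = (SOME x. \<forall>k\<in>{1..N}. slack (\<sigma> k) k x = \<eta> k)"

lemma slack_slack_point:
  assumes "\<And>k. \<sigma> k \<in> {1, - 1}" "k \<in> {1..N}"
  shows "slack (\<sigma> k) k (slack_point \<sigma> \<eta>) = \<eta> k"
proof -
  have "\<sigma> k \<noteq> 0" for k using assms(1)[of k] by auto
  then have "\<exists>x. \<forall>k\<in>{1..N}. facet_normal (\<sigma> k) k \<bullet> x = 10 ^ k - \<eta> k"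
    by (rule facet_normal_system_solvable)
  then obtain x where "\<forall>k\<in>{1..N}. facet_normal (\<sigma> k) k \<bullet> x = 10 ^ k - \<eta> k" by blast
  then have "\<exists>x. \<forall>k\<in>{1..N}. slack (\<sigma> k) k x = \<eta> k" by (intro exI[of _ x]) (simp add: slack_def)
  from someI_ex[OF this] show ?thesis using assms(2) by (simp add: slack_point_def)
qed

lemma slack_system_unique:
  assumes "\<And>k. \<sigma> k \<in> {1, - 1}" "\<And>k. k \<in> {1..N} \<Longrightarrow> slack (\<sigma> k) k x = slack (\<sigma> k) k y"
  shows "x = y"
proof (rule facet_normal_system_unique)
  show "\<sigma> k \<noteq> 0" for k using assms(1)[of k] by auto
qed (use assms(2) in \<open>simp add: slack_def\<close>)

lemma slack_point_slack_opposite: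
  assumes \<sigma>: "\<And>k. \<sigma> k \<in> {1, - 1}" and \<eta>: "\<And>k. k \<in> {1..N} \<Longrightarrow> 0 \<le> \<eta> k \<and> \<eta> k \<le> 1"
    and k: "k \<in> {1..N}"
  shows "7 \<le> slack (- \<sigma> k) k (slack_point \<sigma> \<eta>)"
proof -
  have "\<bar>b j \<bullet> slack_point \<sigma> \<eta>\<bar> \<le> \<bar>radius j (slack_point \<sigma> \<eta>)\<bar> + 1" if j: "j \<in> {1..N}" for j
    using slack_slack_point[of \<sigma>, OF \<sigma> j, of \<eta>] \<eta>[OF j] \<sigma>[of j] by (auto simp: slack_eq)
  then have "4 \<le> radius k (slack_point \<sigma> \<eta>)" using k by (rule radius_ge_4)
  then show ?thesis
    using slack_opposite[of "\<sigma> k" k "slack_point \<sigma> \<eta>"] slack_slack_point[of \<sigma>, OF \<sigma> k, of \<eta>] \<eta>[OF k] by simp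
qed

lemma slack_point_in_cube:
  assumes \<sigma>: "\<And>k. \<sigma> k \<in> {1, - 1}" and \<eta>: "\<And>k. k \<in> {1..N} \<Longrightarrow> 0 \<le> \<eta> k \<and> \<eta> k \<le> 1"
  shows "slack_point \<sigma> \<eta> \<in> cube"
  unfolding cube_def
proof safe
  fix k assume k: "k \<in> {1..N}"
  have "0 \<le> slack (\<sigma> k) k (slack_point \<sigma> \<eta>)" "0 \<le> slack (- \<sigma> k) k (slack_point \<sigma> \<eta>)"
    using slack_slack_point[of \<sigma>, OF \<sigma> k, of \<eta>] \<eta>[OF k] slack_point_slack_opposite[of \<sigma> \<eta>, OF \<sigma> \<eta> k] by simp_all
  then show "0 \<le> slack 1 k (slack_point \<sigma> \<eta>)" "0 \<le> slack (- 1) k (slack_point \<sigma> \<eta>)" using \<sigma>[of k] by auto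
qed

section \<open>The vertices of the cube and its shadow\<close>

abbreviation vert :: "(nat \<Rightarrow> real) \<Rightarrow> 'a" where
  "vert \<sigma> \<equiv> slack_point \<sigma> (\<lambda>_. 0)"

text \<open>The objective lies in the interior of the normal cone: its loss at \<open>x\<close> is
  the sum of the slacks at \<open>x\<close> weighted by \<open>y\<close>.\<close>

lemma vert_unique_maximizer:
  assumes \<sigma>: "\<And>k. \<sigma> k \<in> {1, - 1}" and y: "\<And>k. k \<in> {1..N} \<Longrightarrow> 0 < y k"
  shows "unique_maximizer cube (\<Sum>k=1..N. y k *\<^sub>R facet_normal (\<sigma> k) k) (vert \<sigma>)"
  unfolding unique_maximizer_iff
proof (intro conjI ballI impI)
  show "vert \<sigma> \<in> cube" by (intro slack_point_in_cube \<sigma>) simp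
  fix x assume x: "x \<in> cube" "x \<noteq> vert \<sigma>"
  have nonneg: "0 \<le> slack (\<sigma> k) k x" if "k \<in> {1..N}" for k
    using x \<sigma>[of k] that by (auto simp: cube_def)
  have "\<exists>k\<in>{1..N}. slack (\<sigma> k) k x \<noteq> 0"
  proof (rule ccontr)
    assume "\<not> ?thesis"
    then have "x = vert \<sigma>"
      by (intro slack_system_unique[of \<sigma>] \<sigma>) (simp add: slack_slack_point[of \<sigma>, OF \<sigma>])
    then show False using x by simp
  qed
  then obtain k where k: "k \<in> {1..N}" "0 < slack (\<sigma> k) k x" using nonneg by force
  have "(\<Sum>k=1..N. y k *\<^sub>R facet_normal (\<sigma> k) k) \<bullet> vert \<sigma> - (\<Sum>k=1..N. y k *\<^sub>R facet_normal (\<sigma> k) k) \<bullet> x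
      = (\<Sum>k=1..N. y k * (facet_normal (\<sigma> k) k \<bullet> vert \<sigma> - facet_normal (\<sigma> k) k \<bullet> x))"
    by (simp add: inner_sum_left right_diff_distrib sum_subtractf)
  also have "\<dots> = (\<Sum>k=1..N. y k * slack (\<sigma> k) k x)"
  proof (rule sum.cong)
    fix k assume "k \<in> {1..N}"
    from slack_slack_point[of \<sigma>, OF \<sigma> this, of "\<lambda>_. 0"]
    show "y k * (facet_normal (\<sigma> k) k \<bullet> vert \<sigma> - facet_normal (\<sigma> k) k \<bullet> x) = y k * slack (\<sigma> k) k x"
      by (simp add: slack_def)
  qed simp
  also have "\<dots> > 0"
    by (rule sum_pos2[of _ k]) (use k y nonneg in \<open>auto simp: less_imp_le\<close>)
  finally show "(\<Sum>k=1..N. y k *\<^sub>R facet_normal (\<sigma> k) k) \<bullet> x < (\<Sum>k=1..N. y k *\<^sub>R facet_normal (\<sigma> k) k) \<bullet> vert \<sigma>"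
    by simp
qed

text \<open>The vector \<open>b k\<close> receives \<open>\<sigma> k * y k\<close> from the normal
  of index \<open>k\<close>, \<open>2 * y (k + 1)\<close> from the next and
  \<open>- y (k + 2)\<close> from the one after. The recursion cancels these, so only the last two
  basis vectors remain.\<close>

lemma sum_facet_normal_telescope:
  assumes "1 \<le> m" and "\<And>k. 1 \<le> k \<Longrightarrow> k < m \<Longrightarrow> y (Suc (Suc k)) = 2 * y (Suc k) + \<sigma> k * y k"
  shows "(\<Sum>k=1..m. y k *\<^sub>R facet_normal (\<sigma> k) k) = y (Suc m) *\<^sub>R b (m - 1) + (\<sigma> m * y m) *\<^sub>R b m"
  using assms
proof (induction m rule: dec_induct)
  case base
  then show ?case by (simp add: facet_normal_def)
next
  case (step m)
  have "(\<Sum>k=1..Suc m. y k *\<^sub>R facet_normal (\<sigma> k) k)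
      = y (Suc m) *\<^sub>R b (m - 1) + (\<sigma> m * y m) *\<^sub>R b m + y (Suc m) *\<^sub>R facet_normal (\<sigma> (Suc m)) (Suc m)"
    using step by simp
  also have "\<dots> = (2 * y (Suc m) + \<sigma> m * y m) *\<^sub>R b m + (\<sigma> (Suc m) * y (Suc m)) *\<^sub>R b (Suc m)"
    by (simp add: facet_normal_def algebra_simps)
  finally show ?case using step by simp
qed

text \<open>The sign patterns \<open>apex_sign 1\<close> and \<open>apex_sign (- 1)\<close> belong to the two vertices to be cut off.\<close>

definition apex_sign :: "real \<Rightarrow> nat \<Rightarrow> real" where
  "apex_sign e k = (if k = N then e else - 1)"

lemma apex_sign_sign: "e \<in> {1, - 1} \<Longrightarrow> apex_sign e k \<in> {1, - 1}"
  by (auto simp: apex_sign_def)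

definition obj :: "real \<Rightarrow> 'a" where
  "obj e = (\<Sum>k=1..N. facet_normal (apex_sign e k) k)"

text \<open>Below index \<open>N\<close> the signs are -1, and then constant multipliers 1 satisfy
  the recursion, as 1 = 2 - 1.\<close>

lemma obj_eq: "obj e = b (N - 1) + e *\<^sub>R b N"
  using sum_facet_normal_telescope[of N "\<lambda>_. 1" "apex_sign e"] N_ge_2 by (simp add: obj_def apex_sign_def)

text \<open>The multipliers of \<open>\<sigma>\<close> yield an objective proportional to
  \<open>b (N - 1) + \<tau> *\<^sub>R b N\<close>. By monotonicity \<open>\<tau>\<close> lies
  strictly between -1 and 1, the values belonging to \<open>obj (- 1)\<close> and
  \<open>obj 1\<close>.\<close>

lemma vert_on_shadow:
  assumes \<sigma>: "\<And>k. \<sigma> k \<in> {1, - 1}"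
  shows "\<exists>l. 0 < l \<and> l < 1 \<and> unique_maximizer cube (l *\<^sub>R obj 1 + (1 - l) *\<^sub>R obj (- 1)) (vert \<sigma>)"
proof -
  define y where "y = multiplier \<sigma>"
  have y: "0 \<le> y k" "y k < y (Suc k)" for k
    using multiplier_increasing[of \<sigma> k] \<sigma> by (auto simp: y_def)
  have pos: "0 < y k" if "k \<in> {1..N}" for k
    using that y[of "k - 1"] by simp
  have posS: "0 < y (Suc N)" using y[of N] by linarith
  define \<tau> where "\<tau> = \<sigma> N * y N / y (Suc N)"
  have \<tau>: "- 1 < \<tau>" "\<tau> < 1"
    using \<sigma>[of N] y[of N] posS by (auto simp: \<tau>_def field_simps)
  have "(\<Sum>k=1..N. y k *\<^sub>R facet_normal (\<sigma> k) k) = y (Suc N) *\<^sub>R b (N - 1) + (\<sigma> N * y N) *\<^sub>R b N"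
    using N_ge_2 by (intro sum_facet_normal_telescope) (auto simp: y_def)
  then have "unique_maximizer cube (y (Suc N) *\<^sub>R b (N - 1) + (\<sigma> N * y N) *\<^sub>R b N) (vert \<sigma>)"
    using vert_unique_maximizer[of \<sigma> y, OF \<sigma> pos] by simp
  from unique_maximizer_scale[OF this, of "1 / y (Suc N)"]
  have "unique_maximizer cube (b (N - 1) + \<tau> *\<^sub>R b N) (vert \<sigma>)"
    using posS by (simp add: scaleR_add_right \<tau>_def)
  moreover have "((1 + \<tau>) / 2) *\<^sub>R obj 1 + (1 - (1 + \<tau>) / 2) *\<^sub>R obj (- 1) = b (N - 1) + \<tau> *\<^sub>R b N"
  proof -
    have "((1 + \<tau>) / 2) *\<^sub>R obj 1 + (1 - (1 + \<tau>) / 2) *\<^sub>R obj (- 1)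
        = ((1 + \<tau>) / 2 + (1 - (1 + \<tau>) / 2)) *\<^sub>R b (N - 1) + ((1 + \<tau>) / 2 - (1 - (1 + \<tau>) / 2)) *\<^sub>R b N"
      unfolding obj_eq by (simp only: scaleR_add_left scaleR_add_right scaleR_diff_left) simp
    then show ?thesis by (simp add: field_simps)
  qed
  ultimately show ?thesis
    using \<tau> by (intro exI[of _ "(1 + \<tau>) / 2"]) auto
qed

definition sign_of :: "nat set \<Rightarrow> nat \<Rightarrow> real" where
  "sign_of T k = (if k \<in> T then 1 else - 1)"

lemma sign_of_sign: "sign_of T k \<in> {1, - 1}"
  by (simp add: sign_of_def)

text \<open>A convex mixture of two perturbations below \<open>h\<close> is again below
  \<open>h\<close>, so openness at the mixed objective suffices. The minimum over the finitely many
  vertices gives a common \<open>h\<close>.\<close>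

lemma verts_on_perturbed_shadow:
  "\<exists>h>0. \<forall>T\<in>Pow {1..N}. \<exists>l. 0 < l \<and> l < 1 \<and>
     (\<forall>w c. norm (w - obj 1) < h \<and> norm (c - obj (- 1)) < h \<longrightarrow>
        unique_maximizer cube (l *\<^sub>R w + (1 - l) *\<^sub>R c) (vert (sign_of T)))"
proof -
  let ?R = "\<lambda>T h. \<exists>l. 0 < l \<and> l < 1 \<and>
     (\<forall>w c. norm (w - obj 1) < h \<and> norm (c - obj (- 1)) < h \<longrightarrow>
        unique_maximizer cube (l *\<^sub>R w + (1 - l) *\<^sub>R c) (vert (sign_of T)))"
  have "\<exists>h>0. ?R T h" for T
  proof -
    obtain l where l: "0 < l" "l < 1"
        "unique_maximizer cube (l *\<^sub>R obj 1 + (1 - l) *\<^sub>R obj (- 1)) (vert (sign_of T))"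
      using vert_on_shadow[of "sign_of T"] sign_of_sign by blast
    from unique_maximizer_open[OF polytope_cube l(3)]
    obtain h where h: "h > 0" "\<And>g. dist g (l *\<^sub>R obj 1 + (1 - l) *\<^sub>R obj (- 1)) < h \<Longrightarrow>
        unique_maximizer cube g (vert (sign_of T))"
      by (auto simp: eventually_nhds_metric)
    have "unique_maximizer cube (l *\<^sub>R w + (1 - l) *\<^sub>R c) (vert (sign_of T))"
      if wc: "norm (w - obj 1) < h" "norm (c - obj (- 1)) < h" for w c
    proof (rule h(2))
      have "dist (l *\<^sub>R w + (1 - l) *\<^sub>R c) (l *\<^sub>R obj 1 + (1 - l) *\<^sub>R obj (- 1))
          = norm (l *\<^sub>R (w - obj 1) + (1 - l) *\<^sub>R (c - obj (- 1)))"
        by (simp add: dist_norm algebra_simps)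
      also have "\<dots> \<le> norm (l *\<^sub>R (w - obj 1)) + norm ((1 - l) *\<^sub>R (c - obj (- 1)))"
        by (rule norm_triangle_ineq)
      also have "\<dots> = l * norm (w - obj 1) + (1 - l) * norm (c - obj (- 1))"
        using l by simp
      also have "\<dots> < l * h + (1 - l) * h"
        using wc l by (intro add_strict_mono) auto
      finally show "dist (l *\<^sub>R w + (1 - l) *\<^sub>R c) (l *\<^sub>R obj 1 + (1 - l) *\<^sub>R obj (- 1)) < h"
        by (simp add: algebra_simps)
    qed
    then show ?thesis using h(1) l(1,2) by blast
  qed
  then obtain h where h: "\<And>T. h T > 0" "\<And>T. ?R T (h T)" by metis
  show ?thesis
  proof (rule exI[of _ "Min (h ` Pow {1..N})"], intro conjI ballI)
    show "0 < Min (h ` Pow {1..N})" using h(1) by (subst Min_gr_iff) auto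
    fix T assume "T \<in> Pow {1..N}"
    then have "Min (h ` Pow {1..N}) \<le> h T" by (intro Min_le) auto
    then show "?R T (Min (h ` Pow {1..N}))"
      using h(2)[of T] by (meson less_le_trans)
  qed
qed


section \<open>Total slack and the vertices that are kept\<close>

definition facet_normal_size :: "real \<Rightarrow> real" where
  "facet_normal_size e = (\<Sum>k=1..N. norm (facet_normal (apex_sign e k) k))"

text \<open>Up to a constant this is the negated objective \<open>obj e\<close>; on the cube it
  vanishes only at the vertex to be cut off.\<close>

definition total :: "real \<Rightarrow> 'a \<Rightarrow> real" where
  "total e x = (\<Sum>k=1..N. slack (apex_sign e k) k x)"

lemma total_eq: "total e x = (\<Sum>k=1..N. 10 ^ k) - obj e \<bullet> x"
  by (simp add: total_def slack_def obj_def sum_subtractf inner_sum_left)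

lemma slack_apex_sign_nonneg:
  assumes "x \<in> cube" "e \<in> {1, - 1}" "k \<in> {1..N}"
  shows "0 \<le> slack (apex_sign e k) k x"
  using assms apex_sign_sign[OF assms(2), of k] by (auto simp: cube_def)

lemma slack_le_total:
  assumes "x \<in> cube" "e \<in> {1, - 1}" "k \<in> {1..N}"
  shows "slack (apex_sign e k) k x \<le> total e x"
  unfolding total_def using assms by (intro member_le_sum) (auto intro!: slack_apex_sign_nonneg)

text \<open>The sets \<open>{}\<close> and \<open>{N}\<close> encode the sign patterns
  \<open>apex_sign (- 1)\<close> and \<open>apex_sign 1\<close>, whose vertices are cut off.\<close>

definition mid_sets :: "nat set set" where
  "mid_sets = Pow {1..N} - {{}, {N}}"

lemma finite_mid_sets: "finite mid_sets"
  by (simp add: mid_sets_def)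

lemma card_mid_sets: "card mid_sets + 2 = 2 ^ N"
proof -
  have "{{}, {N}} \<subseteq> Pow {1..N}" using N_ge_2 by auto
  then have "card mid_sets = card (Pow {1..N}) - card {{}, {N}}"
    unfolding mid_sets_def by (intro card_Diff_subset) auto
  then have "card mid_sets = 2 ^ N - 2" by (simp add: card_Pow)
  moreover have "(2::nat) ^ 1 \<le> 2 ^ N" using N_ge_2 by (intro power_increasing) auto
  ultimately show ?thesis by simp
qed

lemma mid_sets_differ:
  assumes T: "T \<in> mid_sets" and e: "e \<in> {1, - 1}"
  shows "\<exists>j\<in>{1..N}. apex_sign e j = - sign_of T j"
proof (rule ccontr)
  assume n: "\<not> ?thesis"
  have eq: "sign_of T j = apex_sign e j" if "j \<in> {1..N}" for j
  proof -
    have "apex_sign e j \<noteq> - sign_of T j" using n that by blast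
    then show ?thesis using apex_sign_sign[OF e, of j] by (auto simp: sign_of_def split: if_splits)
  qed
  have "j \<notin> T" if "j \<in> {1..N} - {N}" for j
    using eq[of j] that by (auto simp: sign_of_def apex_sign_def)
  moreover have "T \<subseteq> {1..N}" using T by (simp add: mid_sets_def)
  ultimately have "T \<subseteq> {N}" by blast
  then show False using T by (auto simp: mid_sets_def subset_singleton_iff)
qed

text \<open>Where the sign differs from the apex sign, the vertex lies on the opposite facet and the
  slack is at least 7. The bound 1 is the threshold used in \<open>cut_pos\<close>.\<close>

lemma mid_vert_slack_ge:
  assumes "T \<in> mid_sets" "e \<in> {1, - 1}"
  shows "\<exists>j\<in>{1..N}. 1 \<le> slack (apex_sign e j) j (vert (sign_of T))"
proof -
  obtain j where j: "j \<in> {1..N}" "apex_sign e j = - sign_of T j"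
    using mid_sets_differ[OF assms] by blast
  have "7 \<le> slack (- sign_of T j) j (vert (sign_of T))"
    using j(1) by (intro slack_point_slack_opposite sign_of_sign) auto
  then show ?thesis using j by (intro bexI[of _ j]) auto
qed

lemma inj_on_vert: "inj_on (\<lambda>T. vert (sign_of T)) mid_sets"
proof (rule inj_onI, rule ccontr)
  fix S T assume *: "S \<in> mid_sets" "T \<in> mid_sets" "vert (sign_of S) = vert (sign_of T)" "S \<noteq> T"
  obtain k where k: "k \<in> S \<longleftrightarrow> k \<notin> T" using *(4) unfolding set_eq_iff by blast
  then have kN: "k \<in> {1..N}" using *(1,2) by (auto simp: mid_sets_def)
  have "7 \<le> slack (- sign_of S k) k (vert (sign_of S))"
    using kN by (intro slack_point_slack_opposite sign_of_sign) auto
  moreover have "slack (sign_of T k) k (vert (sign_of T)) = 0"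
    using kN by (intro slack_slack_point sign_of_sign)
  moreover have "- sign_of S k = sign_of T k" using k by (auto simp: sign_of_def)
  ultimately show False using * by simp
qed

end

section \<open>Cutting off two vertices\<close>

text \<open>The parameter \<open>\<rho>\<close> is the tilt of the cutting hyperplanes against
  \<open>obj e\<close>; \<open>rho_small\<close> keeps the resulting deviation of objectives within
  the tolerance \<open>h\<close>.\<close>

locale cut_cube = deformed_cube b N for b :: "nat \<Rightarrow> 'a::euclidean_space" and N +
  fixes \<rho> h :: real
  assumes rho: "0 < \<rho>" "\<rho> \<le> 1 / 4"
    and rho_small: "e \<in> {1, - 1} \<Longrightarrow> \<rho> * facet_normal_size e < h"
    and h_robust: "T \<in> Pow {1..N} \<Longrightarrow> \<exists>l. 0 < l \<and> l < 1 \<and>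
     (\<forall>w c. norm (w - obj 1) < h \<and> norm (c - obj (- 1)) < h \<longrightarrow>
        unique_maximizer cube (l *\<^sub>R w + (1 - l) *\<^sub>R c) (vert (sign_of T)))"
begin

definition cut :: "real \<Rightarrow> nat \<Rightarrow> 'a \<Rightarrow> real" where
  "cut e k x = total e x - \<rho> * slack (apex_sign e k) k x - 1 / 4"

text \<open>In \<open>(c, e, k)\<close> the flag \<open>c\<close> marks a cut. For a cut,
  \<open>e\<close> selects the apex; for a facet of the cube, it is the sign of coordinate
  \<open>k\<close>.\<close>

definition Con :: "(bool \<times> real \<times> nat) set" where
  "Con = UNIV \<times> {1, - 1} \<times> {1..N}"

definition con_normal :: "bool \<times> real \<times> nat \<Rightarrow> 'a" where
  "con_normal = (\<lambda>(c, e, k). if c then obj e - \<rho> *\<^sub>R facet_normal (apex_sign e k) k else facet_normal e k)"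

definition con_offset :: "bool \<times> real \<times> nat \<Rightarrow> real" where
  "con_offset = (\<lambda>(c, e, k). if c then (\<Sum>j=1..N. 10 ^ j) - \<rho> * 10 ^ k - 1 / 4 else 10 ^ k)"

definition P :: "'a set" where
  "P = hpoly Con con_normal con_offset"

lemma constraint_slack: "con_offset (c, e, k) - con_normal (c, e, k) \<bullet> x = (if c then cut e k x else slack e k x)"
  by (simp add: con_normal_def con_offset_def cut_def total_eq slack_def inner_diff_left algebra_simps)

lemma constraint_le_iff: "con_normal (c, e, k) \<bullet> x \<le> con_offset (c, e, k) \<longleftrightarrow> 0 \<le> (if c then cut e k x else slack e k x)"
  and constraint_eq_iff: "con_normal (c, e, k) \<bullet> x = con_offset (c, e, k) \<longleftrightarrow> (if c then cut e k x else slack e k x) = 0"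
  and constraint_less_iff: "con_normal (c, e, k) \<bullet> x < con_offset (c, e, k) \<longleftrightarrow> 0 < (if c then cut e k x else slack e k x)"
  unfolding constraint_slack[symmetric] by auto

lemma finite_Con: "finite Con"
  by (simp add: Con_def)

lemma card_Con: "card Con = 4 * N"
  by (simp add: Con_def card_cartesian_product)

lemma P_iff: "x \<in> P \<longleftrightarrow> x \<in> cube \<and> (\<forall>e\<in>{1, - 1}. \<forall>k\<in>{1..N}. 0 \<le> cut e k x)"
proof
  assume x: "x \<in> P"
  have "0 \<le> (if c then cut e k x else slack e k x)" if "e \<in> {1, - 1}" "k \<in> {1..N}" for c e k
  proof -
    have "(c, e, k) \<in> Con" using that by (auto simp: Con_def)
    then have "con_normal (c, e, k) \<bullet> x \<le> con_offset (c, e, k)" using x unfolding P_def hpoly_def by blast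
    then show ?thesis by (simp only: constraint_le_iff)
  qed
  from this[of _ _ True] this[of _ _ False]
  show "x \<in> cube \<and> (\<forall>e\<in>{1, - 1}. \<forall>k\<in>{1..N}. 0 \<le> cut e k x)"
    by (simp add: cube_def)
next
  assume "x \<in> cube \<and> (\<forall>e\<in>{1, - 1}. \<forall>k\<in>{1..N}. 0 \<le> cut e k x)"
  then show "x \<in> P"
    by (auto simp: P_def hpoly_def Con_def constraint_le_iff cube_def)
qed

lemma P_subset_cube: "P \<subseteq> cube"
  by (auto simp: P_iff)

text \<open>The total is at least 1 and the tilt takes away at most a quarter of it, which leaves
  more than 1/4.\<close>

lemma cut_pos:
  assumes x: "x \<in> cube" and e: "e \<in> {1, - 1}" and j: "j \<in> {1..N}" "1 \<le> slack (apex_sign e j) j x"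
    and k: "k \<in> {1..N}"
  shows "0 < cut e k x"
proof -
  have t: "1 \<le> total e x" using slack_le_total[OF x e j(1)] j(2) by linarith
  have "\<rho> * slack (apex_sign e k) k x \<le> \<rho> * total e x"
    using slack_le_total[OF x e k] rho by (intro mult_left_mono) auto
  also have "\<dots> \<le> 1 / 4 * total e x" using rho t by (intro mult_right_mono) auto
  finally show ?thesis using t by (simp add: cut_def)
qed

lemma cut_tight_slack_less:
  assumes "x \<in> cube" "e \<in> {1, - 1}" "j \<in> {1..N}" "k \<in> {1..N}" "cut e k x = 0"
  shows "slack (apex_sign e j) j x < 1"
  using cut_pos[OF assms(1,2,3) _ assms(4)] assms(5) by force

lemma cut_tight_slack_opposite:
  assumes "x \<in> cube" "e \<in> {1, - 1}" "j \<in> {1..N}" "k \<in> {1..N}" "cut e k x = 0"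
  shows "7 < slack (- apex_sign e j) j x"
  using cut_tight_slack_less[OF assms] cube_slack_opposite_ge[OF assms(1,3), of "apex_sign e j"] by simp

text \<open>The two apex patterns are opposite at \<open>N\<close>, so a point on a cut of one apex
  has a large slack of index \<open>N\<close> with respect to the other.\<close>

lemma cut_tight_cut_opposite:
  assumes "x \<in> cube" "e \<in> {1, - 1}" "j \<in> {1..N}" "k \<in> {1..N}" "cut e k x = 0"
  shows "0 < cut (- e) j x"
proof (rule cut_pos[OF assms(1) _ _ _ assms(3)])
  show "- e \<in> {1, - 1}" using assms(2) by auto
  show N: "N \<in> {1..N}" using N_ge_2 by simp
  show "1 \<le> slack (apex_sign (- e) N) N x"
    using cut_tight_slack_opposite[OF assms(1,2) N assms(4,5)] by (simp add: apex_sign_def)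
qed

text \<open>If the slack of index \<open>k\<close> vanished too, the total would be exactly 1/4.
  Some slack of another index \<open>i\<close> is then positive, and the cut of index
  \<open>i\<close> would be violated.\<close>

lemma cut_tight_slack_pos:
  assumes x: "x \<in> P" and e: "e \<in> {1, - 1}" and k: "k \<in> {1..N}" and t: "cut e k x = 0"
  shows "0 < slack (apex_sign e k) k x"
proof (rule ccontr)
  assume n: "\<not> ?thesis"
  have xc: "x \<in> cube" using x by (simp add: P_iff)
  have "slack (apex_sign e k) k x = 0" using n slack_apex_sign_nonneg[OF xc e k] by linarith
  then have tot: "total e x = 1 / 4" using t by (simp add: cut_def)
  have "\<exists>i\<in>{1..N}. 0 < slack (apex_sign e i) i x"
  proof (rule ccontr)
    assume "\<not> ?thesis"
    then have "total e x \<le> 0" unfolding total_def by (intro sum_nonpos) force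
    then show False using tot by simp
  qed
  then obtain i where i: "i \<in> {1..N}" "0 < slack (apex_sign e i) i x" by blast
  then have "0 < \<rho> * slack (apex_sign e i) i x" using rho by simp
  moreover have "0 \<le> cut e i x" using x e i unfolding P_iff by blast
  ultimately show False using tot by (simp add: cut_def)
qed

text \<open>At most one of the four constraints with the same index is tight at a point, which is why the
  polytope is simple.\<close>

lemma tight_inj_on:
  assumes x: "x \<in> P"
  shows "inj_on (snd \<circ> snd) {j\<in>Con. con_normal j \<bullet> x = con_offset j}"
proof -
  have xc: "x \<in> cube" using x by (simp add: P_iff)
  \<comment> \<open>A facet of the cube of the same index has either the apex sign, where the slack
    is positive, or the opposite sign, where it exceeds 7.\<close>
  have mixed: False if "e \<in> {1, - 1}" "e' \<in> {1, - 1}" "k \<in> {1..N}" "cut e k x = 0" "slack e' k x = 0" for e e' k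
    using cut_tight_slack_pos[OF x that(1,3,4)] cut_tight_slack_opposite[OF xc that(1,3,3,4)]
      that apex_sign_sign[OF that(1), of k] by auto
  have same: False if "e \<in> {1, - 1}" "k \<in> {1..N}" "slack e k x = 0" "slack (- e) k x = 0" for e k
    using cube_slack_opposite_ge[OF xc that(2), of e] that by simp
  have cuts: False if "e \<in> {1, - 1}" "k \<in> {1..N}" "cut e k x = 0" "cut (- e) k x = 0" for e k
    using cut_tight_cut_opposite[OF xc that(1,2,2,3)] that by simp
  show ?thesis
  proof (rule inj_onI)
    fix i j assume i: "i \<in> {j\<in>Con. con_normal j \<bullet> x = con_offset j}" and j: "j \<in> {j\<in>Con. con_normal j \<bullet> x = con_offset j}"
      and eq: "(snd \<circ> snd) i = (snd \<circ> snd) j"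
    obtain c e k where i': "i = (c, e, k)" by (cases i)
    obtain c' e' where j': "j = (c', e', k)" using eq i' by (cases j) auto
    have k: "k \<in> {1..N}" and ee: "e \<in> {1, - 1}" "e' \<in> {1, - 1}"
      using i j i' j' by (auto simp: Con_def)
    have ti: "(if c then cut e k x else slack e k x) = 0" "(if c' then cut e' k x else slack e' k x) = 0"
      using i j i' j' by (simp_all add: constraint_eq_iff)
    have "c = c'"
      using mixed[OF ee k] mixed[OF ee(2,1) k] ti by (cases c; cases c') auto
    moreover have "e' = - e \<longrightarrow> False"
      using same[OF ee(1) k] cuts[OF ee(1) k] ti \<open>c = c'\<close> by (cases c) auto
    ultimately show "i = j" using i' j' ee by auto
  qed
qed

section \<open>Irredundancy of the constraints\<close>

lemma cut_0:
  assumes "e \<in> {1, - 1}" "k \<in> {1..N}"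
  shows "0 < cut e k 0"
proof (rule cut_pos[OF _ assms _ assms(2)])
  show "0 \<in> cube" by (simp add: cube_def slack_def)
qed (simp add: slack_def)

lemma strictly_feasible_0:
  assumes "j \<in> Con"
  shows "con_normal j \<bullet> 0 < con_offset j"
proof -
  obtain c e k where j: "j = (c, e, k)" "e \<in> {1, - 1}" "k \<in> {1..N}"
    using assms by (auto simp: Con_def)
  show ?thesis
    unfolding j(1) constraint_less_iff using cut_0[OF j(2,3)] by (simp add: slack_def)
qed

lemma facet_witness_cube:
  assumes e: "e \<in> {1, - 1}" and k: "k \<in> {1..N}"
  shows "\<exists>x. slack e k x = 0 \<and> (\<forall>e'\<in>{1, - 1}. \<forall>k'\<in>{1..N}. (e', k') \<noteq> (e, k) \<longrightarrow> 0 < slack e' k' x)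
    \<and> (\<forall>e'\<in>{1, - 1}. \<forall>k'\<in>{1..N}. 0 < cut e' k' x)"
proof -
  \<comment> \<open>All other coordinates are 0, so \<open>radius k x\<close> is
    \<open>10 ^ k\<close> and exactly the constraint of index \<open>k\<close> and sign
    \<open>e\<close> is tight.\<close>
  define x where "x = (e * 10 ^ k) *\<^sub>R b k"
  have bx: "b j \<bullet> x = (if j = k then e * 10 ^ k else 0)" if "j \<le> N" for j
    using k that by (cases "j = 0") (auto simp: x_def b_inner)
  have ee: "e * e = 1" "\<bar>e\<bar> = 1" using e by auto
  have "\<bar>b j \<bullet> x\<bar> \<le> 2 * 10 ^ j" if "j \<le> N" for j
    using bx[OF that] ee by (simp add: abs_mult)
  then have r: "4 \<le> radius j x" if "j \<in> {1..N}" for j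
    using that by (intro radius_bounds) auto
  have rk: "radius k x = 10 ^ k"
    using k bx[of "k - 1"] bx[of "k - 2"] by (auto simp: radius_def)
  have sk: "slack s k x = 10 ^ k - s * e * 10 ^ k" for s
    using bx[of k] k by (simp add: slack_eq rk)
  have sj: "4 \<le> slack s j x" if "j \<in> {1..N}" "j \<noteq> k" for s j
    using bx[of j] r[of j] that by (simp add: slack_eq)
  have s0: "slack e k x = 0" by (simp add: sk ee)
  have pos: "0 < slack e' k' x" if "e' \<in> {1, - 1}" "k' \<in> {1..N}" "(e', k') \<noteq> (e, k)" for e' k'
  proof (cases "k' = k")
    case True
    then have "e' * e = - 1" using that e by auto
    then show ?thesis using True by (simp add: sk)
  next
    case False
    then show ?thesis using sj[of k' e'] that by simp
  qed
  have xc: "x \<in> cube"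
    unfolding cube_def using pos s0 by (force simp: less_imp_le)
  obtain j where j: "j \<in> {1..N}" "j \<noteq> k"
  proof (cases "k = 1")
    case True
    then show ?thesis using that[of 2] N_ge_2 by auto
  next
    case False
    then show ?thesis using that[of 1] N_ge_2 by auto
  qed
  have "0 < cut e' k' x" if "e' \<in> {1, - 1}" "k' \<in> {1..N}" for e' k'
    using cut_pos[OF xc that(1) j(1) _ that(2)] sj[OF j, of "apex_sign e' j"] by simp
  then show ?thesis using s0 pos by blast
qed

lemma facet_witness_cut:
  assumes e: "e \<in> {1, - 1}" and k: "k \<in> {1..N}"
  shows "\<exists>x. cut e k x = 0 \<and> (\<forall>e'\<in>{1, - 1}. \<forall>k'\<in>{1..N}. (e', k') \<noteq> (e, k) \<longrightarrow> 0 < cut e' k' x)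
    \<and> (\<forall>e'\<in>{1, - 1}. \<forall>k'\<in>{1..N}. 0 < slack e' k' x)"
proof -
  \<comment> \<open>With slack \<open>2 * m\<close> at index \<open>k\<close> and \<open>m\<close>
    elsewhere, cut \<open>k\<close> has the value
    \<open>(N + 1) * m - 2 * \<rho> * m - 1 / 4\<close>, and \<open>m\<close> is chosen to make it
    0. The other cuts of this apex then have the value \<open>\<rho> * m\<close>.\<close>
  define m where "m = (1 / 4) / (real N + 1 - 2 * \<rho>)"
  have den: "2 \<le> real N + 1 - 2 * \<rho>" using rho N_ge_2 by simp
  have m: "0 < m" "m \<le> 1 / 2" using den by (auto simp: m_def field_simps)
  define \<eta> where "\<eta> j = (if j = k then 2 * m else m)" for j
  define x where "x = slack_point (apex_sign e) \<eta>"
  have s: "slack (apex_sign e j) j x = \<eta> j" if "j \<in> {1..N}" for j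
    unfolding x_def using that by (intro slack_slack_point apex_sign_sign e)
  have opp: "7 \<le> slack (- apex_sign e j) j x" if "j \<in> {1..N}" for j
    unfolding x_def using that m by (intro slack_point_slack_opposite apex_sign_sign e) (auto simp: \<eta>_def)
  have xc: "x \<in> cube"
    unfolding x_def using m by (intro slack_point_in_cube apex_sign_sign e) (auto simp: \<eta>_def)
  have "total e x = (\<Sum>j=1..N. m + (if j = k then m else 0))"
    unfolding total_def by (rule sum.cong) (auto simp: s \<eta>_def)
  also have "\<dots> = real N * m + m" using k by (simp add: sum.distrib)
  finally have tot: "total e x = real N * m + m" .
  have "(real N + 1 - 2 * \<rho>) * m = 1 / 4" using den by (simp add: m_def)
  then have ck: "cut e k x = 0" using k by (simp add: cut_def tot s \<eta>_def algebra_simps)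
  moreover have "0 < cut e' k' x" if "e' \<in> {1, - 1}" "k' \<in> {1..N}" "(e', k') \<noteq> (e, k)" for e' k'
  proof (cases "e' = e")
    case True
    then have "k' \<noteq> k" using that by simp
    then have "cut e' k' x = cut e k x + \<rho> * m"
      using that k True by (simp add: cut_def s \<eta>_def)
    then show ?thesis using ck rho m by simp
  next
    case False
    then have "e' = - e" using that e by auto
    then show ?thesis using cut_tight_cut_opposite[OF xc e that(2) k ck] by simp
  qed
  moreover have "0 < slack e' k' x" if "e' \<in> {1, - 1}" "k' \<in> {1..N}" for e' k'
  proof -
    have "0 < slack (apex_sign e k') k' x" "0 < slack (- apex_sign e k') k' x"
      using s[OF that(2)] opp[OF that(2)] m by (auto simp: \<eta>_def)
    then show ?thesis using apex_sign_sign[OF e, of k'] that by auto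
  qed
  ultimately show ?thesis by blast
qed

lemma facet_witness:
  assumes "j \<in> Con"
  shows "\<exists>x. con_normal j \<bullet> x = con_offset j \<and> (\<forall>i\<in>Con - {j}. con_normal i \<bullet> x < con_offset i)"
proof -
  obtain c e k where j: "j = (c, e, k)" "e \<in> {1, - 1}" "k \<in> {1..N}"
    using assms by (auto simp: Con_def)
  have "\<exists>x. (if c then cut e k x else slack e k x) = 0 \<and>
      (\<forall>c'. \<forall>e'\<in>{1, - 1}. \<forall>k'\<in>{1..N}. (c', e', k') \<noteq> (c, e, k) \<longrightarrow> 0 < (if c' then cut e' k' x else slack e' k' x))"
  proof (cases c)
    case True
    then show ?thesis using facet_witness_cut[OF j(2,3)] by (elim exE) (rule_tac x = x in exI, auto)
  next
    case False
    then show ?thesis using facet_witness_cube[OF j(2,3)] by (elim exE) (rule_tac x = x in exI, auto)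
  qed
  then obtain x where x: "(if c then cut e k x else slack e k x) = 0"
    "\<forall>c'. \<forall>e'\<in>{1, - 1}. \<forall>k'\<in>{1..N}. (c', e', k') \<noteq> (c, e, k) \<longrightarrow> 0 < (if c' then cut e' k' x else slack e' k' x)"
    by (elim exE conjE) (rule that)
  show ?thesis
  proof (intro exI conjI ballI)
    show "con_normal j \<bullet> x = con_offset j" using x(1) by (simp only: j(1) constraint_eq_iff)
    fix i assume i: "i \<in> Con - {j}"
    obtain c' e' k' where i': "i = (c', e', k')" by (cases i)
    then have i'': "e' \<in> {1, - 1}" "k' \<in> {1..N}" "(c', e', k') \<noteq> (c, e, k)" using i j(1) by (auto simp: Con_def)
    show "con_normal i \<bullet> x < con_offset i"
      unfolding i' constraint_less_iff using i'' by (rule x(2)[rule_format])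
  qed
qed

lemma bounded_P: "bounded P"
  using bounded_subset[OF bounded_cube P_subset_cube] .

lemma simple_polytope_P: "simple_polytope P"
  unfolding P_def
proof (rule simple_polytope_hpoly[where K = "{1..N}" and g = "snd \<circ> snd" and ?x0.0 = 0])
  show "bounded (hpoly Con con_normal con_offset)" using bounded_P by (simp add: P_def)
  show "inj_on (snd \<circ> snd) {j \<in> Con. con_normal j \<bullet> x = con_offset j}" if "x \<in> hpoly Con con_normal con_offset" for x
    using tight_inj_on that by (simp add: P_def)
qed (use finite_Con strictly_feasible_0 facet_witness in \<open>auto simp: DIM_eq Con_def\<close>)

lemma aff_dim_P: "aff_dim P = int N"
  unfolding P_def using hpoly_facets(1)[OF finite_Con strictly_feasible_0 facet_witness] by (simp add: DIM_eq)

lemma card_facets_P: "card {F. F facet_of P} = 4 * N"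
proof -
  note f = hpoly_facets[OF finite_Con strictly_feasible_0 facet_witness]
  show ?thesis
    unfolding P_def by (simp only: f(2) card_image[OF f(3)] card_Con)
qed

subsection \<open>Paths and shadows between the two apices\<close>

text \<open>The common slack at the new vertex: with all slacks equal to \<open>gap\<close>, each
  cut has the value \<open>N * gap - \<rho> * gap - 1 / 4 = 0\<close>.\<close>

definition gap :: real where
  "gap = 1 / 4 / (real N - \<rho>)"

definition apex :: "real \<Rightarrow> 'a" where
  "apex e = slack_point (apex_sign e) (\<lambda>_. gap)"

lemma gap_bounds: "0 < gap" "gap \<le> 1" and gap_eq: "(real N - \<rho>) * gap = 1 / 4"
proof -
  have "1 \<le> real N - \<rho>" using rho N_ge_2 by simp
  then show "0 < gap" "gap \<le> 1" "(real N - \<rho>) * gap = 1 / 4"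
    by (auto simp: gap_def field_simps)
qed

lemma slack_apex:
  assumes "e \<in> {1, - 1}" "k \<in> {1..N}"
  shows "slack (apex_sign e k) k (apex e) = gap"
  unfolding apex_def using assms by (intro slack_slack_point apex_sign_sign)

lemma slack_apex_opposite:
  assumes "e \<in> {1, - 1}" "k \<in> {1..N}"
  shows "7 \<le> slack (- apex_sign e k) k (apex e)"
  unfolding apex_def using assms gap_bounds by (intro slack_point_slack_opposite apex_sign_sign) (auto simp: less_imp_le)

lemma slack_apex_pos:
  assumes "e \<in> {1, - 1}" "s \<in> {1, - 1}" "k \<in> {1..N}"
  shows "0 < slack s k (apex e)"
proof -
  have "0 < slack (apex_sign e k) k (apex e)" "0 < slack (- apex_sign e k) k (apex e)"
    using slack_apex[OF assms(1,3)] slack_apex_opposite[OF assms(1,3)] gap_bounds by simp_all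
  then show ?thesis using apex_sign_sign[OF assms(1), of k] assms(2) by auto
qed

lemma apex_in_cube: "e \<in> {1, - 1} \<Longrightarrow> apex e \<in> cube"
  using slack_apex_pos unfolding cube_def by (auto intro: less_imp_le)

lemma total_apex: "e \<in> {1, - 1} \<Longrightarrow> total e (apex e) = real N * gap"
  unfolding total_def by (simp add: slack_apex)

lemma cut_apex:
  assumes "e \<in> {1, - 1}" "k \<in> {1..N}"
  shows "cut e k (apex e) = 0"
  using gap_eq unfolding cut_def total_apex[OF assms(1)] slack_apex[OF assms]
  by (simp add: left_diff_distrib)

lemma cut_apex_opposite:
  assumes "e \<in> {1, - 1}" "k \<in> {1..N}"
  shows "0 < cut (- e) k (apex e)"
  by (rule cut_tight_cut_opposite[OF apex_in_cube[OF assms(1)] assms assms(2) cut_apex[OF assms]])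

lemma apex_in_P:
  assumes e: "e \<in> {1, - 1}"
  shows "apex e \<in> P"
  unfolding P_iff
proof (intro conjI ballI)
  fix e' :: real and k assume "e' \<in> {1, - 1}" "k \<in> {1..N}"
  moreover from this have "e' = e \<or> e' = - e" using e by auto
  ultimately show "0 \<le> cut e' k (apex e)"
    using cut_apex[OF e] cut_apex_opposite[OF e] by (auto simp: less_imp_le)
qed (use apex_in_cube e in auto)

lemma apex_tight:
  assumes e: "e \<in> {1, - 1}" and j: "j \<in> Con" "con_normal j \<bullet> apex e = con_offset j"
  shows "\<exists>k\<in>{1..N}. j = (True, e, k)"
proof -
  obtain c e' k where j': "j = (c, e', k)" "e' \<in> {1, - 1}" "k \<in> {1..N}"
    using j(1) by (auto simp: Con_def)
  have t: "(if c then cut e' k (apex e) else slack e' k (apex e)) = 0"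
    using j(2) by (simp only: j'(1) constraint_eq_iff)
  have c: c using t slack_apex_pos[OF e j'(2,3)] by (cases c) auto
  have "e' \<noteq> - e" using t c cut_apex_opposite[OF e j'(3)] by auto
  then show ?thesis using j' c e by auto
qed

text \<open>The cuts add up to \<open>(N - \<rho>) * total - N / 4\<close>, so their nonnegativity
  bounds the total from below and hence \<open>obj e\<close> from above. Equality makes all cuts
  tight, which forces every slack to be \<open>gap\<close>.\<close>

lemma apex_unique_maximizer:
  assumes e: "e \<in> {1, - 1}"
  shows "unique_maximizer P (obj e) (apex e)"
  unfolding unique_maximizer_iff
proof (intro conjI ballI impI apex_in_P e)
  fix x assume x: "x \<in> P" "x \<noteq> apex e"
  have den: "0 < real N - \<rho>" using rho N_ge_2 by simp
  have "(real N - \<rho>) * (real N * gap) = real N * ((real N - \<rho>) * gap)"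
    by (rule mult.left_commute)
  then have gap: "(real N - \<rho>) * (real N * gap) = real N / 4" by (simp add: gap_eq)
  have cuts: "0 \<le> cut e k x" if "k \<in> {1..N}" for k
    using x(1) e that unfolding P_iff by blast
  have sum: "(\<Sum>k=1..N. cut e k x) = (real N - \<rho>) * total e x - real N / 4"
    by (simp add: cut_def sum_subtractf left_diff_distrib total_def flip: sum_distrib_left)
  have "\<exists>k\<in>{1..N}. cut e k x \<noteq> 0"
  proof (rule ccontr)
    assume "\<not> ?thesis"
    then have z: "cut e k x = 0" if "k \<in> {1..N}" for k using that by blast
    then have "(real N - \<rho>) * total e x = real N / 4" using sum by simp
    then have tot: "total e x = real N * gap" using den gap by (metis less_irrefl mult_left_cancel)
    have "slack (apex_sign e k) k x = slack (apex_sign e k) k (apex e)" if "k \<in> {1..N}" for k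
    proof -
      have "real N * gap - \<rho> * gap = 1 / 4" using gap_eq by (simp only: left_diff_distrib)
      moreover have "real N * gap - \<rho> * slack (apex_sign e k) k x - 1 / 4 = 0"
        using z[OF that] by (simp only: cut_def tot)
      ultimately have "\<rho> * slack (apex_sign e k) k x = \<rho> * gap" by linarith
      then show ?thesis using rho slack_apex[OF e that] by simp
    qed
    then have "x = apex e" by (rule slack_system_unique[OF apex_sign_sign[OF e]])
    then show False using x by simp
  qed
  then obtain k where "k \<in> {1..N}" "0 < cut e k x" using cuts by force
  then have "0 < (\<Sum>k=1..N. cut e k x)" using cuts by (intro sum_pos2[of _ k]) auto
  then have "real N / 4 < (real N - \<rho>) * total e x" using sum by simp
  also have "real N / 4 = (real N - \<rho>) * total e (apex e)"
    by (simp add: total_apex[OF e] gap)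
  finally have "total e (apex e) < total e x" using den by simp
  then show "obj e \<bullet> x < obj e \<bullet> apex e" by (simp add: total_eq)
qed

lemma apex_neq: "apex 1 \<noteq> apex (- 1)"
proof
  assume eq: "apex 1 = apex (- 1)"
  have "N \<in> {1..N}" using N_ge_2 by simp
  then have "slack 1 N (apex 1) \<le> 1" "7 \<le> slack 1 N (apex (- 1))"
    using slack_apex[of 1 N] slack_apex_opposite[of "- 1" N] gap_bounds(2) by (simp_all add: apex_sign_def)
  then show False using eq by simp
qed

text \<open>Moving from the apex so that coordinate i of the slacks decreases by \<open>1 - \<rho>\<close> while coordinate j
  increases by 1 stays inside the polytope. Hence the weights of a normal vector at the apex
  differ at most by the factor \<open>1 - \<rho>\<close>.\<close>

lemma narrow_normal_cone:
  assumes e: "e \<in> {1, - 1}" and max: "maximizer P w (apex e)" and w: "w \<noteq> 0"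
  shows "\<exists>t>0. norm (t *\<^sub>R w - obj e) < h"
    and "\<And>x j. x \<in> P \<Longrightarrow> j \<in> {1..N} \<Longrightarrow> 1 \<le> slack (apex_sign e j) j x \<Longrightarrow> w \<bullet> x < w \<bullet> apex e"
proof -
  let ?n = "\<lambda>k. facet_normal (apex_sign e k) k"
  have sg0: "apex_sign e k \<noteq> 0" for k using apex_sign_sign[OF e, of k] by auto
  obtain \<psi> where \<psi>: "w = (\<Sum>k=1..N. \<psi> k *\<^sub>R ?n k)"
    using facet_normal_combination[of "apex_sign e" w] sg0 by blast
  \<comment> \<open>Here \<open>d\<close> prescribes the rates of change of the slacks. The
    condition says that no cut tight at the apex decreases, so the direction is feasible and the
    objective cannot increase along it.\<close>
  have dir: "0 \<le> (\<Sum>k=1..N. \<psi> k * d k)"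
    if d: "\<And>i. i \<in> {1..N} \<Longrightarrow> \<rho> * d i \<le> (\<Sum>k=1..N. d k)" for d
  proof -
    obtain D where D: "\<forall>k\<in>{1..N}. ?n k \<bullet> D = - d k"
      using facet_normal_system_solvable[of "apex_sign e" "\<lambda>k. - d k"] sg0 by blast
    have "obj e \<bullet> D = - (\<Sum>k=1..N. d k)"
      using D by (simp add: obj_def inner_sum_left flip: sum_negf)
    then have "con_normal j \<bullet> D \<le> 0" if "j \<in> Con" "con_normal j \<bullet> apex e = con_offset j" for j
      using apex_tight[OF e that] d D by (auto simp: con_normal_def inner_diff_left)
    then have "eventually (\<lambda>t. apex e + t *\<^sub>R D \<in> P) (at_right 0)"
      using apex_in_P[OF e] finite_Con unfolding P_def by (intro hpoly_feasible_direction) auto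
    moreover have "eventually (\<lambda>t::real. 0 < t) (at_right 0)" by (rule eventually_at_right_less)
    ultimately have "eventually (\<lambda>t. apex e + t *\<^sub>R D \<in> P \<and> 0 < t) (at_right 0)"
      by eventually_elim simp
    from eventually_happens[OF this] obtain t :: real where t: "apex e + t *\<^sub>R D \<in> P" "0 < t" by auto
    then have "t * (w \<bullet> D) \<le> 0"
      using max by (force simp: maximizer_def inner_add_right)
    then have "w \<bullet> D \<le> 0" using t(2) by (simp add: mult_le_0_iff)
    moreover have "w \<bullet> D = - (\<Sum>k=1..N. \<psi> k * d k)"
      using D by (simp add: \<psi> inner_sum_left flip: sum_negf)
    ultimately show ?thesis by simp
  qed
  have nonneg: "0 \<le> \<psi> j" if j: "j \<in> {1..N}" for j
  proof -
    have "\<rho> * (if i = j then 1 else 0) \<le> (\<Sum>k=1..N. if k = j then 1 else 0)" for i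
      using j rho by simp
    from dir[OF this] have "0 \<le> (\<Sum>k=1..N. \<psi> k * (if k = j then 1 else 0))" .
    also have "\<dots> = (\<Sum>k=1..N. if k = j then \<psi> k else 0)" by (rule sum.cong) auto
    finally show ?thesis using j by simp
  qed
  have ratio: "(1 - \<rho>) * \<psi> i \<le> \<psi> j" if i: "i \<in> {1..N}" and j: "j \<in> {1..N}" for i j
  proof (cases "i = j")
    case True
    then show ?thesis using nonneg[OF j] rho by (simp add: left_diff_distrib)
  next
    case False
    let ?d = "\<lambda>k. (if k = j then 1 else 0) - (if k = i then 1 - \<rho> else 0)"
    have sum: "(\<Sum>k=1..N. ?d k) = \<rho>" using i j by (simp add: sum_subtractf)
    have "\<rho> * ?d k \<le> (\<Sum>k=1..N. ?d k)" for k
      unfolding sum using rho mult_left_mono[of "?d k" 1 \<rho>] by auto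
    from dir[OF this] have "0 \<le> (\<Sum>k=1..N. \<psi> k * ?d k)" .
    also have "(\<Sum>k=1..N. \<psi> k * ?d k) = (\<Sum>k=1..N. (if k = j then \<psi> k else 0) - (if k = i then (1 - \<rho>) * \<psi> k else 0))"
      by (rule sum.cong) (auto simp: algebra_simps)
    also have "\<dots> = \<psi> j - (1 - \<rho>) * \<psi> i" using i j by (simp add: sum_subtractf)
    finally show ?thesis by simp
  qed
  define M where "M = Max (\<psi> ` {1..N})"
  have ne: "\<psi> ` {1..N} \<noteq> {}" using N_ge_2 by simp
  have leM: "\<psi> k \<le> M" if "k \<in> {1..N}" for k using that by (simp add: M_def)
  have "M \<in> \<psi> ` {1..N}" unfolding M_def using ne by (intro Max_in) auto
  then obtain i where i: "i \<in> {1..N}" "M = \<psi> i" by auto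
  have geM: "(1 - \<rho>) * M \<le> \<psi> k" if "k \<in> {1..N}" for k using ratio[OF i(1) that] i(2) by simp
  have Mpos: "0 < M"
  proof (rule ccontr)
    assume "\<not> ?thesis"
    then have "\<psi> k = 0" if "k \<in> {1..N}" for k using leM[OF that] nonneg[OF that] by simp
    then show False using w \<psi> by simp
  qed
  show "\<exists>t>0. norm (t *\<^sub>R w - obj e) < h"
  proof (intro exI conjI)
    \<comment> \<open>After division by the largest weight all weights lie in
      \<open>[1 - \<rho>, 1]\<close>, whereas those of \<open>obj e\<close> are 1.\<close>
    show "0 < 1 / M" using Mpos by simp
    have "(1 / M) *\<^sub>R w - obj e = (\<Sum>k=1..N. (\<psi> k / M - 1) *\<^sub>R ?n k)"
      by (simp add: \<psi> obj_def scaleR_sum_right sum_subtractf scaleR_diff_left)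
    also have "norm \<dots> \<le> (\<Sum>k=1..N. norm ((\<psi> k / M - 1) *\<^sub>R ?n k))" by (rule norm_sum)
    also have "\<dots> \<le> (\<Sum>k=1..N. \<rho> * norm (?n k))"
    proof (rule sum_mono)
      fix k assume k: "k \<in> {1..N}"
      have "1 - \<rho> \<le> \<psi> k / M" "\<psi> k / M \<le> 1" using geM[OF k] leM[OF k] Mpos by (simp_all add: field_simps)
      then have "\<bar>\<psi> k / M - 1\<bar> \<le> \<rho>" by simp
      then show "norm ((\<psi> k / M - 1) *\<^sub>R ?n k) \<le> \<rho> * norm (?n k)" by (simp add: mult_right_mono)
    qed
    also have "\<dots> = \<rho> * facet_normal_size e" by (simp add: facet_normal_size_def sum_distrib_left)
    also have "\<dots> < h" by (rule rho_small[OF e])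
    finally show "norm ((1 / M) *\<^sub>R w - obj e) < h" .
  qed
  \<comment> \<open>Both losses are measured from the vertex that was cut off: at \<open>x\<close>
    the loss is at least \<open>(1 - \<rho>) * M\<close>, hence at least \<open>3 / 4 * M\<close>,
    and at the apex at most \<open>M / 2\<close>.\<close>
  fix x j assume x: "x \<in> P" and j: "j \<in> {1..N}" "1 \<le> slack (apex_sign e j) j x"
  have xc: "x \<in> cube" using x P_subset_cube by blast
  have "w \<bullet> apex e - w \<bullet> x = (\<Sum>k=1..N. \<psi> k * (?n k \<bullet> apex e - ?n k \<bullet> x))"
    by (simp add: \<psi> inner_sum_left right_diff_distrib sum_subtractf)
  also have "\<dots> = (\<Sum>k=1..N. \<psi> k * slack (apex_sign e k) k x - \<psi> k * gap)"
  proof (rule sum.cong)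
    fix k assume "k \<in> {1..N}"
    from slack_apex[OF e this] have eq: "?n k \<bullet> apex e = 10 ^ k - gap" by (simp add: slack_def)
    show "\<psi> k * (?n k \<bullet> apex e - ?n k \<bullet> x) = \<psi> k * slack (apex_sign e k) k x - \<psi> k * gap"
      unfolding eq slack_def by (simp only: algebra_simps)
  qed simp
  also have "\<dots> = (\<Sum>k=1..N. \<psi> k * slack (apex_sign e k) k x) - (\<Sum>k=1..N. \<psi> k * gap)"
    by (rule sum_subtractf)
  finally have eq: "w \<bullet> apex e - w \<bullet> x = \<dots>" .
  have "(1 - \<rho>) * M * 1 \<le> \<psi> j * slack (apex_sign e j) j x"
    using geM[OF j(1)] j rho Mpos nonneg[OF j(1)] by (intro mult_mono) auto
  also have "\<dots> \<le> (\<Sum>k=1..N. \<psi> k * slack (apex_sign e k) k x)"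
    using j(1) nonneg slack_apex_sign_nonneg[OF xc e] by (intro member_le_sum[of j "{1..N}" "\<lambda>k. \<psi> k * slack (apex_sign e k) k x"]) auto
  finally have lower: "(1 - \<rho>) * M \<le> (\<Sum>k=1..N. \<psi> k * slack (apex_sign e k) k x)" by simp
  have "(\<Sum>k=1..N. \<psi> k * gap) \<le> (\<Sum>k=1..N. M * gap)"
    using leM gap_bounds(1) by (intro sum_mono mult_right_mono) auto
  also have "\<dots> = M * (real N * gap)" by simp
  also have "\<dots> \<le> M * (1 / 2)"
  proof (rule mult_left_mono)
    show "real N * gap \<le> 1 / 2" using rho N_ge_2 by (simp add: gap_def field_simps)
  qed (use Mpos in simp)
  finally have upper: "(\<Sum>k=1..N. \<psi> k * gap) \<le> M / 2" by simp
  have "3 / 4 * M \<le> (1 - \<rho>) * M" using rho Mpos by (intro mult_right_mono) auto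
  then show "w \<bullet> x < w \<bullet> apex e" using eq lower upper Mpos by linarith
qed

section \<open>Lower bounds for paths and shadows\<close>

lemma mid_vert_in_P:
  assumes T: "T \<in> mid_sets"
  shows "vert (sign_of T) \<in> P"
  unfolding P_iff
proof (intro conjI ballI)
  show c: "vert (sign_of T) \<in> cube" by (intro slack_point_in_cube sign_of_sign) simp
  fix e :: real and k assume e: "e \<in> {1, - 1}" and k: "k \<in> {1..N}"
  obtain j where "j \<in> {1..N}" "1 \<le> slack (apex_sign e j) j (vert (sign_of T))"
    using mid_vert_slack_ge[OF T e] by blast
  then show "0 \<le> cut e k (vert (sign_of T))" using cut_pos[OF c e _ _ k] by force
qed

lemma mid_vert_cut_pos:
  assumes T: "T \<in> mid_sets" and e: "e \<in> {1, - 1}" and k: "k \<in> {1..N}"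
  shows "0 < cut e k (vert (sign_of T))"
proof -
  obtain j where "j \<in> {1..N}" "1 \<le> slack (apex_sign e j) j (vert (sign_of T))"
    using mid_vert_slack_ge[OF T e] by blast
  then show ?thesis
    using cut_pos[OF _ e _ _ k] mid_vert_in_P[OF T] P_subset_cube by blast
qed

lemma mid_vert_neq_apex:
  assumes T: "T \<in> mid_sets" and e: "e \<in> {1, - 1}"
  shows "vert (sign_of T) \<noteq> apex e"
  using mid_vert_cut_pos[OF T e, of N] cut_apex[OF e, of N] N_ge_2 by force

text \<open>The objectives are close to \<open>obj 1\<close> and \<open>obj (- 1)\<close> only after
  rescaling; dividing by \<open>a\<close> turns the rescaled mixture back into a convex combination
  of \<open>w\<close> and \<open>c\<close>. Plain maximality at the apices is assumed so that
  objectives pulled back from a shadow are covered.\<close>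

lemma mid_vert_on_path:
  assumes w: "maximizer P w (apex 1)" "w \<noteq> 0" and c: "maximizer P c (apex (- 1))" "c \<noteq> 0"
    and T: "T \<in> mid_sets"
  shows "\<exists>s. 0 \<le> s \<and> s \<le> 1 \<and> unique_maximizer P (s *\<^sub>R w + (1 - s) *\<^sub>R c) (vert (sign_of T))"
proof -
  obtain t where t: "0 < t" "norm (t *\<^sub>R w - obj 1) < h"
    using narrow_normal_cone(1)[OF _ w] by auto
  obtain t' where t': "0 < t'" "norm (t' *\<^sub>R c - obj (- 1)) < h"
    using narrow_normal_cone(1)[OF _ c] by auto
  have TP: "T \<in> Pow {1..N}" using T by (simp add: mid_sets_def)
  obtain l where l: "0 < l" "l < 1"
    "unique_maximizer cube (l *\<^sub>R (t *\<^sub>R w) + (1 - l) *\<^sub>R (t' *\<^sub>R c)) (vert (sign_of T))"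
    using h_robust[OF TP] t(2) t'(2) by blast
  define a where "a = l * t + (1 - l) * t'"
  have a: "0 < l * t" "0 < (1 - l) * t'" "0 < a" using l t t' by (auto simp: a_def intro: add_pos_pos)
  have "unique_maximizer P (l *\<^sub>R (t *\<^sub>R w) + (1 - l) *\<^sub>R (t' *\<^sub>R c)) (vert (sign_of T))"
    using unique_maximizer_mono[OF l(3) P_subset_cube mid_vert_in_P[OF T]] .
  from unique_maximizer_scale[OF this, of "1 / a"] a
  have "unique_maximizer P ((l * t / a) *\<^sub>R w + ((1 - l) * t' / a) *\<^sub>R c) (vert (sign_of T))"
    by (simp add: scaleR_add_right)
  moreover have "(1 - l) * t' / a = 1 - l * t / a" using a by (simp add: a_def field_simps)
  ultimately show ?thesis
    using a by (intro exI[of _ "l * t / a"]) (auto simp: a_def)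
qed

text \<open>The \<open>2 ^ N - 2\<close> kept vertices, the two apices and \<open>p 1\<close> are
  \<open>2 ^ N + 1\<close> distinct points among the \<open>l + 1\<close> positions of the
  path.\<close>

lemma coherent_path_length:
  assumes "coherent_path P (apex 1) (apex (- 1)) l p"
  shows "2 ^ N \<le> l"
proof -
  obtain w c where wc: "coherent_path_for P w c (apex 1) (apex (- 1)) l p"
    using assms by (auto simp: coherent_path_def)
  have uw: "unique_maximizer P w (apex 1)" and uc: "unique_maximizer P c (apex (- 1))"
    and p0: "p 0 = apex 1" and pl: "p l = apex (- 1)"
    and edge: "\<And>i. i < l \<Longrightarrow> closed_segment (p i) (p (Suc i)) edge_of P"
    and ext: "\<And>i. i \<le> l \<Longrightarrow> p i extreme_point_of P"
    and all: "\<And>x s. x extreme_point_of P \<Longrightarrow> 0 \<le> s \<Longrightarrow> s \<le> 1 \<Longrightarrow>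
        maximizer P (s *\<^sub>R w + (1 - s) *\<^sub>R c) x \<Longrightarrow> \<exists>i\<le>l. x = p i"
    using wc unfolding coherent_path_for_def by blast+
  have w0: "w \<noteq> 0" using uw apex_in_P[of "- 1"] apex_neq by (auto simp: unique_maximizer_iff)
  have c0: "c \<noteq> 0" using uc apex_in_P[of 1] apex_neq by (auto simp: unique_maximizer_iff)
  have maxw: "maximizer P w (apex 1)" and maxc: "maximizer P c (apex (- 1))"
    using uw uc by (simp_all add: unique_maximizer_def)
  have l: "0 < l" using p0 pl apex_neq by (cases l) auto
  have p1P: "p 1 \<in> P" using ext[of 1] l by (simp add: extreme_point_of_def)
  have e1: "closed_segment (apex 1) (p 1) edge_of P" using edge[of 0] l p0 by simp
  have p1_neq_u: "p 1 \<noteq> apex 1" using e1 by (auto simp: edge_of_def)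
  \<comment> \<open>Only the cuts of \<open>apex 1\<close> are tight there, so a point strictly
    inside all of them cannot be its neighbour.\<close>
  have no_edge: "p 1 \<noteq> x" if x: "x \<in> P" "\<And>k. k \<in> {1..N} \<Longrightarrow> 0 < cut 1 k x" for x
  proof -
    have "\<not> closed_segment (apex 1) x edge_of P"
      unfolding P_def
    proof (rule hpoly_not_edge[OF finite_Con])
      show "2 \<le> aff_dim (hpoly Con con_normal con_offset)" using aff_dim_P N_ge_2 by (simp add: P_def)
      fix j assume "j \<in> Con" "con_normal j \<bullet> apex 1 = con_offset j"
      then obtain k where k: "k \<in> {1..N}" "j = (True, 1, k)" using apex_tight[of 1 j] by auto
      show "con_normal j \<bullet> x < con_offset j" unfolding k(2) constraint_less_iff using x(2)[OF k(1)] by simp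
    qed (use x apex_in_P[of 1] in \<open>auto simp: P_def\<close>)
    then show ?thesis using e1 by auto
  qed
  have p1_neq_v: "p 1 \<noteq> apex (- 1)"
    using no_edge[OF apex_in_P[of "- 1"]] cut_apex_opposite[of "- 1"] by simp
  have p1_mid: "p 1 \<noteq> vert (sign_of T)" if "T \<in> mid_sets" for T
    using no_edge[OF mid_vert_in_P[OF that]] mid_vert_cut_pos[OF that, of 1] by simp
  let ?V = "(\<lambda>T. vert (sign_of T)) ` mid_sets"
  have "?V \<subseteq> p ` {..l}"
  proof (rule image_subsetI)
    fix T assume T: "T \<in> mid_sets"
    obtain s where s: "0 \<le> s" "s \<le> 1" "unique_maximizer P (s *\<^sub>R w + (1 - s) *\<^sub>R c) (vert (sign_of T))"
      using mid_vert_on_path[OF maxw w0 maxc c0 T] by blast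
    then have "\<exists>i\<le>l. vert (sign_of T) = p i"
      by (intro all[of _ s] unique_maximizer_extreme[OF s(3)]) (auto simp: unique_maximizer_def)
    then show "vert (sign_of T) \<in> p ` {..l}" by auto
  qed
  moreover have "apex 1 \<in> p ` {..l}" using p0 by (intro image_eqI[of _ _ 0]) auto
  moreover have "apex (- 1) \<in> p ` {..l}" using pl by (intro image_eqI[of _ _ l]) auto
  moreover have "p 1 \<in> p ` {..l}" using l by auto
  ultimately have "insert (apex 1) (insert (apex (- 1)) (insert (p 1) ?V)) \<subseteq> p ` {..l}" by blast
  then have "card (insert (apex 1) (insert (apex (- 1)) (insert (p 1) ?V))) \<le> card (p ` {..l})"
    by (intro card_mono) auto
  also have "\<dots> \<le> Suc l" using card_image_le[of "{..l}" p] by simp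
  also have "card (insert (apex 1) (insert (apex (- 1)) (insert (p 1) ?V))) = card ?V + 3"
  proof -
    have "p 1 \<notin> ?V" using p1_mid by auto
    moreover have "apex (- 1) \<notin> insert (p 1) ?V"
      using p1_neq_v mid_vert_neq_apex[of _ "- 1"] by force
    moreover have "apex 1 \<notin> insert (apex (- 1)) (insert (p 1) ?V)"
      using p1_neq_u apex_neq mid_vert_neq_apex[of _ 1] by force
    ultimately show ?thesis using finite_mid_sets by simp
  qed
  also have "card ?V = card mid_sets" by (rule card_image[OF inj_on_vert])
  finally show ?thesis using card_mid_sets by linarith
qed

text \<open>Supporting lines at the images of the apices pull back along the adjoint to objectives
  maximized at the apices, so all kept vertices project to vertices. The images of the apices need
  not be extreme; the two missing vertices are taken from the faces cut out by the supporting
  lines.\<close>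

lemma shadow_vertices:
  fixes \<pi> :: "'a \<Rightarrow> real^2"
  assumes \<pi>: "shadow_map P \<pi>"
    and fr: "\<pi> (apex 1) \<in> frontier (\<pi> ` P)" "\<pi> (apex (- 1)) \<in> frontier (\<pi> ` P)"
  shows "2 ^ N \<le> card {x. x extreme_point_of (\<pi> ` P)}"
proof -
  have lin: "linear \<pi>" and dim: "aff_dim (\<pi> ` P) = 2"
    using \<pi> by (auto simp: shadow_map_def)
  have polyP: "polytope P" using simple_polytope_P by (simp add: simple_polytope_def)
  have poly: "polytope (\<pi> ` P)" using polytope_linear_image[OF lin polyP] .
  have adj: "adjoint \<pi> a \<bullet> x = a \<bullet> \<pi> x" for a x
    using adjoint_works[OF lin, of x a] by (simp add: inner_commute)
  \<comment> \<open>The shadow has full dimension in the plane, so its frontier points lie outside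
    the relative interior.\<close>
  have int: "interior (\<pi> ` P) = rel_interior (\<pi> ` P)"
    using dim by (intro rel_interior_interior[symmetric]) (simp add: flip: aff_dim_eq_full)
  have support: "\<exists>a. adjoint \<pi> a \<noteq> 0 \<and> maximizer P (adjoint \<pi> a) (apex e)"
    if e: "e \<in> {1, - 1}" and f: "\<pi> (apex e) \<in> frontier (\<pi> ` P)" for e :: real
  proof -
    have "\<pi> (apex e) \<notin> rel_interior (\<pi> ` P)" using f int by (simp add: frontier_def)
    moreover have "\<pi> (apex e) \<in> \<pi> ` P" using apex_in_P[OF e] by blast
    ultimately obtain a where a: "\<And>y. y \<in> \<pi> ` P \<Longrightarrow> a \<bullet> \<pi> (apex e) \<le> a \<bullet> y"
      "\<And>y. y \<in> rel_interior (\<pi> ` P) \<Longrightarrow> a \<bullet> \<pi> (apex e) < a \<bullet> y"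
      using supporting_hyperplane_rel_boundary[OF polytope_imp_convex[OF poly]] by metis
    have ne: "rel_interior (\<pi> ` P) \<noteq> {}"
      using apex_in_P[OF e] polytope_imp_convex[OF poly] by (auto simp: rel_interior_eq_empty)
    then obtain z where z: "z \<in> rel_interior (\<pi> ` P)" by blast
    then obtain x where x: "x \<in> P" "z = \<pi> x" using rel_interior_subset by blast
    \<comment> \<open>The supporting line provides a minimum, hence the sign change. Strictness on
      the relative interior shows that the pulled-back objective is not 0.\<close>
    have "adjoint \<pi> (- a) \<bullet> x < adjoint \<pi> (- a) \<bullet> apex e" using a(2)[OF z] x by (simp add: adj)
    then have "adjoint \<pi> (- a) \<noteq> 0" by auto
    moreover have "maximizer P (adjoint \<pi> (- a)) (apex e)"
      using a(1) apex_in_P[OF e] by (auto simp: maximizer_def adj)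
    ultimately show ?thesis by blast
  qed
  obtain a where a: "adjoint \<pi> a \<noteq> 0" "maximizer P (adjoint \<pi> a) (apex 1)" using support[OF _ fr(1)] by auto
  obtain c where c: "adjoint \<pi> c \<noteq> 0" "maximizer P (adjoint \<pi> c) (apex (- 1))" using support[OF _ fr(2)] by auto
  have top: "\<exists>y. y extreme_point_of (\<pi> ` P) \<and> a \<bullet> y = a \<bullet> \<pi> (apex e)"
    if e: "e \<in> {1, - 1}" and m: "maximizer P (adjoint \<pi> a) (apex e)" for e :: real and a
  proof -
    let ?F = "\<pi> ` P \<inter> {y. a \<bullet> y = a \<bullet> \<pi> (apex e)}"
    have F: "?F face_of (\<pi> ` P)"
      using m by (intro face_of_Int_supporting_hyperplane_le polytope_imp_convex[OF poly]) (auto simp: maximizer_def adj)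
    then have "compact ?F" "convex ?F"
      using face_of_imp_compact[OF polytope_imp_convex[OF poly] polytope_imp_compact[OF poly]] face_of_imp_convex by blast+
    moreover have "?F \<noteq> {}" using apex_in_P[OF e] by auto
    ultimately obtain y where "y extreme_point_of ?F" using extreme_point_exists_convex by blast
    then show ?thesis using extreme_point_of_face[OF F] by auto
  qed
  obtain y where y: "y extreme_point_of (\<pi> ` P)" "a \<bullet> y = a \<bullet> \<pi> (apex 1)" using top[OF _ a(2)] by auto
  obtain z where z: "z extreme_point_of (\<pi> ` P)" "c \<bullet> z = c \<bullet> \<pi> (apex (- 1))" using top[OF _ c(2)] by auto
  obtain yy where yy: "yy \<in> P" "y = \<pi> yy" using y(1) by (auto simp: extreme_point_of_def)
  obtain zz where zz: "zz \<in> P" "z = \<pi> zz" using z(1) by (auto simp: extreme_point_of_def)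
  \<comment> \<open>Preimages of points on the supporting line have all slacks below 1. This
    separates \<open>y\<close> from the images of the kept vertices and, with its counterpart for
    \<open>z\<close>, \<open>y\<close> from \<open>z\<close>.\<close>
  have small: "slack (apex_sign 1 j) j x < 1" if "x \<in> P" "j \<in> {1..N}" "a \<bullet> \<pi> x = a \<bullet> \<pi> (apex 1)" for x j
    using narrow_normal_cone(2)[OF _ a(2,1) that(1,2)] that(3) by (force simp: adj)
  have small': "slack (apex_sign (- 1) j) j x < 1" if "x \<in> P" "j \<in> {1..N}" "c \<bullet> \<pi> x = c \<bullet> \<pi> (apex (- 1))" for x j
    using narrow_normal_cone(2)[OF _ c(2,1) that(1,2)] that(3) by (force simp: adj)
  have Nm: "N \<in> {1..N}" using N_ge_2 by simp
  have "y \<noteq> z"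
  proof
    assume "y = z"
    then have "slack 1 N yy < 1" "slack (- 1) N yy < 1"
      using small[OF yy(1) Nm] small'[OF yy(1) Nm] y z yy by (simp_all add: apex_sign_def)
    moreover have "8 \<le> slack 1 N yy + slack (- 1) N yy"
      using cube_slack_opposite_ge[OF _ Nm] yy(1) P_subset_cube by blast
    ultimately show False by simp
  qed
  let ?v = "\<lambda>T. \<pi> (vert (sign_of T))"
  have um: "\<exists>g. unique_maximizer P (adjoint \<pi> g) (vert (sign_of T))" if T: "T \<in> mid_sets" for T
  proof -
    obtain s where "unique_maximizer P (s *\<^sub>R adjoint \<pi> a + (1 - s) *\<^sub>R adjoint \<pi> c) (vert (sign_of T))"
      using mid_vert_on_path[OF a(2,1) c(2,1) T] by blast
    moreover have "s *\<^sub>R adjoint \<pi> a + (1 - s) *\<^sub>R adjoint \<pi> c = adjoint \<pi> (s *\<^sub>R a + (1 - s) *\<^sub>R c)"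
      using adjoint_linear[OF lin] by (simp add: linear_add linear_scale)
    ultimately show ?thesis by metis
  qed
  have extv: "?v T extreme_point_of (\<pi> ` P)" if T: "T \<in> mid_sets" for T
  proof -
    obtain g where g: "unique_maximizer P (adjoint \<pi> g) (vert (sign_of T))" using um[OF T] by blast
    have "unique_maximizer (\<pi> ` P) g (?v T)"
      using g unfolding unique_maximizer_iff adj by auto
    then show ?thesis by (rule unique_maximizer_extreme)
  qed
  have inj: "inj_on ?v mid_sets"
  proof (rule inj_onI, rule ccontr)
    fix S T assume *: "S \<in> mid_sets" "T \<in> mid_sets" "?v S = ?v T" "S \<noteq> T"
    obtain g where g: "unique_maximizer P (adjoint \<pi> g) (vert (sign_of S))" using um[OF *(1)] by blast
    have "vert (sign_of T) \<noteq> vert (sign_of S)" using inj_on_vert * by (metis inj_onD)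
    then show False using g mid_vert_in_P[OF *(2)] *(3) unfolding unique_maximizer_iff adj by force
  qed
  have y_neq: "y \<noteq> ?v T" if T: "T \<in> mid_sets" for T
  proof
    assume "y = ?v T"
    moreover obtain j where "j \<in> {1..N}" "1 \<le> slack (apex_sign 1 j) j (vert (sign_of T))"
      using mid_vert_slack_ge[OF T] by blast
    ultimately show False using small[OF mid_vert_in_P[OF T]] y(2) by force
  qed
  have z_neq: "z \<noteq> ?v T" if T: "T \<in> mid_sets" for T
  proof
    assume "z = ?v T"
    moreover obtain j where "j \<in> {1..N}" "1 \<le> slack (apex_sign (- 1) j) j (vert (sign_of T))"
      using mid_vert_slack_ge[OF T] by blast
    ultimately show False using small'[OF mid_vert_in_P[OF T]] z(2) by force
  qed
  have "insert y (insert z (?v ` mid_sets)) \<subseteq> {x. x extreme_point_of (\<pi> ` P)}"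
    using y z extv by auto
  then have "card (insert y (insert z (?v ` mid_sets))) \<le> card {x. x extreme_point_of (\<pi> ` P)}"
    by (intro card_mono finite_polyhedron_extreme_points polytope_imp_polyhedron poly)
  moreover have "y \<notin> insert z (?v ` mid_sets)" "z \<notin> ?v ` mid_sets"
    using \<open>y \<noteq> z\<close> y_neq z_neq by auto
  then have "card (insert y (insert z (?v ` mid_sets))) = card mid_sets + 2"
    using finite_mid_sets card_image[OF inj] by simp
  ultimately show ?thesis using card_mid_sets by simp
qed

end

text \<open>Dimension 1 is excluded because a segment has two facets rather than four.\<close>

theorem theorem1p2:
  assumes "CARD('n::finite) \<ge> 2"
  shows "\<exists>(P :: (real^'n) set) u v.
           simple_polytope P \<and> aff_dim P = int CARD('n) \<and>
           card {F. F facet_of P} = 4 * CARD('n) \<and>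
           u extreme_point_of P \<and> v extreme_point_of P \<and> u \<noteq> v \<and>
           (\<forall>l p. coherent_path P u v l p \<longrightarrow> 2 ^ CARD('n) \<le> l) \<and>
           (\<forall>\<pi>. shadow_map P \<pi> \<and>
                 \<pi> u \<in> frontier (\<pi> ` P) \<and> \<pi> v \<in> frontier (\<pi> ` P) \<longrightarrow>
                 2 ^ CARD('n) \<le> card {x. x extreme_point_of (\<pi> ` P)})"
proof -
  have card: "card (Basis :: (real^'n) set) = CARD('n)" by simp
  obtain f where f: "bij_betw f {1..CARD('n)} (Basis :: (real^'n) set)"
    using ex_bij_betw_nat_finite_1[OF finite_Basis, where 'a1 = "real^'n"] unfolding card by blast
  define b where "b k = (if k = 0 then 0 else f k)" for k
  have "bij_betw b {1..CARD('n)} Basis"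
    using f by (rule iffD1[OF bij_betw_cong, rotated]) (auto simp: b_def)
  then interpret deformed_cube b "CARD('n)"
    using assms by unfold_locales (auto simp: b_def)
  obtain h where h: "0 < h" "\<forall>T\<in>Pow {1..CARD('n)}. \<exists>l. 0 < l \<and> l < 1 \<and>
     (\<forall>w c. norm (w - obj 1) < h \<and> norm (c - obj (- 1)) < h \<longrightarrow>
        unique_maximizer cube (l *\<^sub>R w + (1 - l) *\<^sub>R c) (vert (sign_of T)))"
    using verts_on_perturbed_shadow by blast
  \<comment> \<open>The summand 1 makes \<open>K\<close> positive and strictly larger than both
    sizes, so \<open>\<rho> * K \<le> h\<close> yields the strict bound required of
    \<open>\<rho>\<close>.\<close>
  define K where "K = facet_normal_size 1 + facet_normal_size (- 1) + 1"
  have size: "0 \<le> facet_normal_size e" for e by (simp add: facet_normal_size_def sum_nonneg)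
  have K: "0 < K" "facet_normal_size 1 < K" "facet_normal_size (- 1) < K"
    using size[of 1] size[of "- 1"] by (simp_all add: K_def)
  define \<rho> where "\<rho> = min (1 / 4) (h / K)"
  have rho: "0 < \<rho>" "\<rho> \<le> 1 / 4" "\<rho> * K \<le> h"
    using h(1) K(1) by (auto simp: \<rho>_def min_def field_simps)
  interpret cut_cube b "CARD('n)" \<rho> h
  proof unfold_locales
    fix e :: real assume "e \<in> {1, - 1}"
    then have "\<rho> * facet_normal_size e < \<rho> * K" using K rho by auto
    then show "\<rho> * facet_normal_size e < h" using rho(3) by linarith
  qed (use rho h in blast)+
  show ?thesis
  proof (intro exI conjI allI impI)
    show "simple_polytope P" by (rule simple_polytope_P)
    show "aff_dim P = int CARD('n)" by (rule aff_dim_P)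
    show "card {F. F facet_of P} = 4 * CARD('n)" by (rule card_facets_P)
    show "apex 1 extreme_point_of P" "apex (- 1) extreme_point_of P"
      by (rule unique_maximizer_extreme[OF apex_unique_maximizer]; simp)+
    show "apex 1 \<noteq> apex (- 1)" by (rule apex_neq)
  qed (auto intro: coherent_path_length shadow_vertices)
qed

end
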